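(* There is a universal constant $\kappa>0$, and for each $D\ge1$ a constant $\alpha_D\ge \frac{\kappa}{D^3}$ depending only on $D$, such that the following holds. Let $\mu$ be an even log-concave probability measure on $\mathbb R$ with positive and $C^1$-bounded density $\varphi_\mu$. Assume that $I_\mu\ge J$ on $[0,1]$, where $J$ is a non-negative function on $[0,1]$ which is symmetric with respect to $1/2$ (i.e. $J(t)=J(1-t)$ for all $t\in[0,1]$), verifies $J(0)=0$, and is such that $t\mapsto J(t)/(t\log(1/t))$ is essentially non-decreasing on $(0,1)$ with constant $D$. Then for every $n\ge1$ and every Borel set $A\subset\mathbb R^n$, $$\max_{1\le i\le n}\mathcal I_i^{\mathcal G}(A)\ \ge\ \alpha_D\,\mu^n(A)\,\mu^n(A^c)\,J\Big(\frac1n\Big).$$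
   Context: For a Borel probability measure $\mu$ on $\mathbb R$ (with the usual distance) and a Borel set $B\subseteq\mathbb R$, let $B_r=\{x : d(x,B)<r\}$, $\mu^+(B)=\liminf_{r\to0^+}\frac{\mu(B_r)-\mu(B)}{r}$ and $\mu^-(B)=\mu^+(\mathbb R\setminus B)$. The isoperimetric function is, for $p\in[0,1]$, $I_\mu(p)=\inf\{\min(\mu^+(B),\mu^-(B)) : B\subseteq\mathbb R\text{ Borel},\ \mu(B)=p\}$. $\mu^n$ denotes the $n$-fold product measure on $\mathbb R^n$. Geometric influence: for $A\subseteq\mathbb R^n$ Borel, $i\in\{1,\dots,n\}$ and $z\in\mathbb R^{n-1}$, set $A_i^z=\{y\in\mathbb R : (z_1,\dots,z_{i-1},y,z_i,\dots,z_{n-1})\in A\}$. The geometric influence of the $i$-th coordinate on $A$ with respect to $\mu^n$ is $$\mathcal I_i^{\mathcal G}(A)=\int_{\mathbb R^{n-1}}\mu^+(A_i^z)\,d\mu^{n-1}(z).$$ A log-concave probability measure on $\mathbb R$ is one with density $e^{-V}$, $V$ convex. "$C^1$-bounded density" means that the density is of class $C^1$ and that it and its derivative are bounded. For non-negative functions $f,g$ on $S\subset\mathbb R$ and $D\ge1$, $f\approx_D g$ means that there is $a>0$ with $a\,g(x)\le f(x)\le D\,a\,g(x)$ for all $x\in S$. A non-negative $f$ on $S$ is essentially non-decreasing with constant $D$ if there is a non-decreasing $g$ on $S$ with $f\approx_D g$. *)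

theory Defs
  imports "HOL-Probability.Probability"
begin

(* B_r = {x. d(x,B) < r} with the convention d(x,{}) = \<infinity>; the library has infdist x {} = 0. *)
definition enlargement :: "real set \<Rightarrow> real \<Rightarrow> real set" where
  "enlargement B r = {x. B \<noteq> {} \<and> infdist x B < r}"

(* For r > 0 the quotient is non-negative, so the embedding into ennreal loses nothing. *)
definition outer_boundary_measure :: "real measure \<Rightarrow> real set \<Rightarrow> ennreal" where
  "outer_boundary_measure \<mu> B =
     Liminf (at_right 0) (\<lambda>r. ennreal ((measure \<mu> (enlargement B r) - measure \<mu> B) / r))"

definition inner_boundary_measure :: "real measure \<Rightarrow> real set \<Rightarrow> ennreal" where
  "inner_boundary_measure \<mu> B = outer_boundary_measure \<mu> (- B)"

definition isoperimetric_function :: "real measure \<Rightarrow> real \<Rightarrow> ennreal" where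
  "isoperimetric_function \<mu> p =
     (INF B \<in> {B \<in> sets borel. measure \<mu> B = p}.
        min (outer_boundary_measure \<mu> B) (inner_boundary_measure \<mu> B))"

(* R^n is represented by the extensional functions on {1..n}; the sets of this product
   measure are then the Borel sets of R^n whenever \<mu> is a Borel measure. *)
definition power_measure :: "nat \<Rightarrow> real measure \<Rightarrow> (nat \<Rightarrow> real) measure" where
  "power_measure n \<mu> = PiM {1..n} (\<lambda>_. \<mu>)"

(* The n-1 coordinates of z keep their original labels {1..n} - {i}, so that inserting y at
   position i is z(i := y). For Borel A the integrand is in general measurable only for the
   completion of the product measure (enlargements of sections involve projections of Borel
   sets); nn_integral_completion shows that the integral below is the one with respect to
   that completion. *)
definition geometric_influence ::
  "nat \<Rightarrow> real measure \<Rightarrow> nat \<Rightarrow> (nat \<Rightarrow> real) set \<Rightarrow> ennreal" where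
  "geometric_influence n \<mu> i A =
     (\<integral>\<^sup>+ z. outer_boundary_measure \<mu> {y. z(i := y) \<in> A} \<partial>(PiM ({1..n} - {i}) (\<lambda>_. \<mu>)))"

definition log_concave_prob :: "real measure \<Rightarrow> bool" where
  "log_concave_prob \<mu> \<longleftrightarrow> prob_space \<mu> \<and>
     (\<exists>V. convex_on UNIV V \<and> \<mu> = density lborel (\<lambda>x. ennreal (exp (- V x))))"

definition even_measure :: "real measure \<Rightarrow> bool" where
  "even_measure \<mu> \<longleftrightarrow> distr \<mu> borel uminus = \<mu>"

definition C1_bounded :: "(real \<Rightarrow> real) \<Rightarrow> bool" where
  "C1_bounded \<phi> \<longleftrightarrow>
     (\<exists>\<phi>'. (\<forall>x. (\<phi> has_real_derivative \<phi>' x) (at x)) \<and> continuous_on UNIV \<phi>' \<and>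
           bounded (range \<phi>) \<and> bounded (range \<phi>'))"

definition approx_const :: "real \<Rightarrow> real set \<Rightarrow> (real \<Rightarrow> real) \<Rightarrow> (real \<Rightarrow> real) \<Rightarrow> bool" where
  "approx_const D S f g \<longleftrightarrow> (\<exists>a>0. \<forall>x\<in>S. a * g x \<le> f x \<and> f x \<le> D * a * g x)"

definition essentially_nondecreasing :: "real \<Rightarrow> real set \<Rightarrow> (real \<Rightarrow> real) \<Rightarrow> bool" where
  "essentially_nondecreasing D S f \<longleftrightarrow>
     (\<forall>x\<in>S. 0 \<le> f x) \<and>
     (\<exists>g. (\<forall>x\<in>S. 0 \<le> g x) \<and> mono_on S g \<and> approx_const D S f g)"

end

theory Submission
  imports Defs "HOL-Library.Nat_Bijection"
begin

text \<open>
  Fix a Borel set \<open>A\<close> and write \<open>p\<^sub>i(z)\<close> for the measure of its section in direction \<open>i\<close> at \<open>z\<close>, and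
  \<open>a\<close> for the measure of \<open>A\<close>. Applied to each section, the isoperimetric inequality bounds the
  \<open>i\<close>-th geometric influence from below by the mean of \<open>J(p\<^sub>i)\<close>, so that the geometry
  disappears and what is left is a statement about products of probability spaces.

  The monotonicity hypothesis on \<open>J\<close> is then used twice. Comparing the points \<open>1/n \<le> t \<le> 1/2\<close>
  shows that \<open>J(t)\<close> is at least of order \<open>n J(1/n) / ln n\<close> times the entropy \<open>t ln (1/t)\<close>.
  Comparing \<open>1 - 1/n < 1 - t\<close> instead, and using the symmetry of \<open>J\<close>, gives a bound that is linear
  in \<open>t\<close> below \<open>1/n\<close>, where the entropy bound is not available. Both bounds together say that \<open>J\<close>
  dominates an entropy with the logarithm truncated at \<open>ln n\<close>. The convenient form of this
  truncated entropy is \<open>H(t) = (\<Sum>k=1..K. min (2\<^sup>-\<^sup>k) t (1 - t))\<close>, which is concave and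
  piecewise linear, with \<open>2\<^sup>K\<close> of the order of \<open>n\<^sup>4\<close> (\<open>entropy_profile_lower_bound\<close>).

  It remains to show that in every product of \<open>n\<close> copies of a probability space some direction
  satisfies \<open>E H(p\<^sub>i) \<ge> c a (1 - a) ln n / n\<close> (\<open>dyadic_entropy_influence\<close>). This is a
  Kahn-Kalai-Linial inequality for entropy influences, and it is reduced to the classical cube.

    \<^item> Sampling. Draw \<open>M = 2\<^sup>K\<close> independent points for each coordinate. The combinations of sampled
      points that fall into \<open>A\<close> form a random subset of the grid \<open>{0..<M}\<^sup>n\<close>. As \<open>M\<close> is much
      larger than \<open>n\<close>, two independent points of the grid rarely share a coordinate, so first and
      second moments of the relevant statistics are close to those of \<open>A\<close>. The means of \<open>H\<close> can
      only decrease, because \<open>H\<close> is concave.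

    \<^item> Compression. Pushing all fibres of a subset of the grid down, one direction after the other,
      gives a down-set of the same size. The distributions of the fibre sizes of the down-set
      majorize the old ones, and so the means of the concave function \<open>H\<close> decrease again.

    \<^item> Binary digits. A fibre of a down-set is an initial segment of \<open>{0..<M}\<close>. Flipping the digit of
      weight \<open>2\<^sup>-\<^sup>k\<close> (after division by \<open>M\<close>) can leave or enter an initial segment of proportion \<open>p\<close>
      for at most a proportion \<open>2 min (2\<^sup>-\<^sup>k) p (1 - p)\<close> of the points. Summed over all digits this is
      \<open>2 H(p)\<close>: this is where the entropy comes from, and it turns the problem into one about the
      influences of the bits of a Boolean cube.

    \<^item> Cube. The inequality of Kahn, Kalai and Linial is proved with Walsh functions and
      Bonami's fourth moment bound for polynomials of low degree (\<open>kkl_inequality\<close>).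
\<close>

section \<open>Walsh functions on the discrete cube\<close>

text \<open>
  Points of the cube are encoded as subsets \<open>X\<close> of a finite set of bits. Characters are indexed by
  subsets \<open>S\<close> as well, so the pairing of characters and points is symmetric.
\<close>

definition walsh :: "'a set \<Rightarrow> 'a set \<Rightarrow> real" where
  "walsh S X = (-1) ^ card (S \<inter> X)"

definition toggle :: "'a \<Rightarrow> 'a set \<Rightarrow> 'a set" where
  "toggle e X = (if e \<in> X then X - {e} else insert e X)"

lemma toggle_toggle [simp]: "toggle e (toggle e X) = X"
  by (auto simp: toggle_def)

lemma toggle_in_Pow: "e \<in> E \<Longrightarrow> X \<in> Pow E \<Longrightarrow> toggle e X \<in> Pow E"
  by (auto simp: toggle_def)

lemma sum_toggle:
  assumes "e \<in> E"
  shows "(\<Sum>X\<in>Pow E. f (toggle e X)) = (\<Sum>X\<in>Pow E. f X)"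
  by (rule sum.reindex_bij_witness[where i = "toggle e" and j = "toggle e"])
     (use assms in \<open>simp_all add: toggle_in_Pow del: Pow_iff\<close>)

lemma walsh_commute: "walsh S X = walsh X S"
  by (simp add: walsh_def Int_commute)

lemma walsh_empty [simp]: "walsh {} X = 1"
  by (simp add: walsh_def)

lemma walsh_square [simp]: "walsh S X * walsh S X = 1"
  by (simp add: walsh_def flip: power_mult_distrib)

lemma walsh_toggle:
  assumes "finite S"
  shows "walsh S (toggle e X) = (if e \<in> S then - walsh S X else walsh S X)"
proof (cases "e \<in> S")
  case True
  show ?thesis
  proof (cases "e \<in> X")
    case True
    then have "S \<inter> X = insert e (S \<inter> (X - {e}))" using \<open>e \<in> S\<close> by auto
    then have "card (S \<inter> X) = Suc (card (S \<inter> (X - {e})))"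
      using assms by (metis Diff_iff IntD2 card_insert_disjoint finite_Int insertI1)
    then show ?thesis using True \<open>e \<in> S\<close> by (simp add: walsh_def toggle_def)
  next
    case False
    then have "card (S \<inter> insert e X) = Suc (card (S \<inter> X))"
      using \<open>e \<in> S\<close> assms by simp
    then show ?thesis using False \<open>e \<in> S\<close> by (simp add: walsh_def toggle_def)
  qed
next
  case False
  then have "S \<inter> toggle e X = S \<inter> X" by (auto simp: toggle_def)
  then show ?thesis using False by (simp add: walsh_def)
qed

lemma walsh_orthogonal:
  assumes "finite E" "S \<subseteq> E" "T \<subseteq> E"
  shows "(\<Sum>X\<in>Pow E. walsh S X * walsh T X) = (if S = T then 2 ^ card E else 0)"
proof (cases "S = T")
  case True
  then show ?thesis using assms by (simp add: card_Pow)
next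
  case False
  then obtain e where e: "(e \<in> S) \<noteq> (e \<in> T)" by blast
  then have "e \<in> E" using assms by blast
  have fin: "finite S" "finite T" using assms finite_subset by auto
  have "(\<Sum>X\<in>Pow E. walsh S X * walsh T X)
      = (\<Sum>X\<in>Pow E. walsh S (toggle e X) * walsh T (toggle e X))"
    using sum_toggle[OF \<open>e \<in> E\<close>, of "\<lambda>X. walsh S X * walsh T X"] by simp
  also have "\<dots> = - (\<Sum>X\<in>Pow E. walsh S X * walsh T X)"
    using e fin by (auto simp: walsh_toggle sum_negf)
  finally show ?thesis using False by simp
qed

definition walsh_coeff :: "'a set \<Rightarrow> ('a set \<Rightarrow> real) \<Rightarrow> 'a set \<Rightarrow> real" where
  "walsh_coeff E f S = (\<Sum>X\<in>Pow E. f X * walsh S X) / 2 ^ card E"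

lemma walsh_inversion:
  assumes "finite E" "X \<subseteq> E"
  shows "f X = (\<Sum>S\<in>Pow E. walsh_coeff E f S * walsh S X)"
proof -
  have "(\<Sum>S\<in>Pow E. walsh_coeff E f S * walsh S X)
      = (\<Sum>S\<in>Pow E. \<Sum>Y\<in>Pow E. f Y * (walsh Y S * walsh X S)) / 2 ^ card E"
  proof -
    have "walsh_coeff E f S * walsh S X = (\<Sum>Y\<in>Pow E. f Y * (walsh Y S * walsh X S)) / 2 ^ card E" for S
      unfolding walsh_coeff_def walsh_commute[of S]
      by (simp add: sum_distrib_right mult.assoc)
    then show ?thesis by (simp only: sum_divide_distrib)
  qed
  also have "\<dots> = (\<Sum>Y\<in>Pow E. f Y * (\<Sum>S\<in>Pow E. walsh Y S * walsh X S)) / 2 ^ card E"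
    by (subst sum.swap) (simp add: sum_distrib_left)
  also have "\<dots> = (\<Sum>Y\<in>Pow E. f Y * (if Y = X then 2 ^ card E else 0)) / 2 ^ card E"
    using assms by (intro arg_cong2[where f = "(/)"] sum.cong refl arg_cong2[where f = "(*)"] walsh_orthogonal) auto
  also have "\<dots> = f X"
    using assms by (simp add: if_distrib[of "\<lambda>u. _ * u"] sum.delta cong: if_cong)
  finally show ?thesis by simp
qed

lemma walsh_synthesis_inner:
  assumes "finite E"
  shows "(\<Sum>X\<in>Pow E. f X * (\<Sum>S\<in>Pow E. c S * walsh S X)) / 2 ^ card E
       = (\<Sum>S\<in>Pow E. walsh_coeff E f S * c S)"
proof -
  have "(\<Sum>X\<in>Pow E. f X * (\<Sum>S\<in>Pow E. c S * walsh S X))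
      = (\<Sum>S\<in>Pow E. (\<Sum>X\<in>Pow E. f X * walsh S X) * c S)"
    unfolding sum_distrib_left sum_distrib_right
    by (subst sum.swap) (simp add: mult_ac)
  then show ?thesis by (simp add: walsh_coeff_def sum_divide_distrib[symmetric])
qed

lemma walsh_coeff_synthesis:
  assumes "finite E" "T \<subseteq> E"
  shows "walsh_coeff E (\<lambda>X. \<Sum>S\<in>Pow E. c S * walsh S X) T = c T"
proof -
  have "walsh_coeff E (\<lambda>X. \<Sum>S\<in>Pow E. c S * walsh S X) T
     = (\<Sum>S\<in>Pow E. walsh_coeff E (walsh T) S * c S)"
    using walsh_synthesis_inner[OF assms(1), of "walsh T" c]
    by (simp add: walsh_coeff_def mult.commute)
  also have "\<dots> = (\<Sum>S\<in>Pow E. (if S = T then c S else 0))"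
    using assms by (intro sum.cong refl) (auto simp: walsh_coeff_def walsh_orthogonal)
  finally show ?thesis using assms by (simp add: sum.delta)
qed

lemma walsh_parseval:
  assumes "finite E"
  shows "(\<Sum>X\<in>Pow E. (f X)\<^sup>2) / 2 ^ card E = (\<Sum>S\<in>Pow E. (walsh_coeff E f S)\<^sup>2)"
proof -
  have "(\<Sum>X\<in>Pow E. (f X)\<^sup>2) = (\<Sum>X\<in>Pow E. f X * (\<Sum>S\<in>Pow E. walsh_coeff E f S * walsh S X))"
    using assms by (intro sum.cong refl) (auto simp: power2_eq_square walsh_inversion[symmetric])
  then show ?thesis
    by (simp only: walsh_synthesis_inner[OF assms] power2_eq_square)
qed

lemma walsh_coeff_derivative:
  assumes "finite E" "e \<in> E" "S \<subseteq> E"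
  shows "walsh_coeff E (\<lambda>X. f X - f (toggle e X)) S = (if e \<in> S then 2 * walsh_coeff E f S else 0)"
proof -
  have "finite S" using assms finite_subset by auto
  have "(\<Sum>X\<in>Pow E. f (toggle e X) * walsh S X) = (\<Sum>X\<in>Pow E. f X * walsh S (toggle e X))"
    using sum_toggle[OF \<open>e \<in> E\<close>, of "\<lambda>X. f (toggle e X) * walsh S X"] by simp
  also have "\<dots> = (if e \<in> S then -1 else 1) * (\<Sum>X\<in>Pow E. f X * walsh S X)"
    using \<open>finite S\<close> by (simp add: walsh_toggle sum_negf)
  finally show ?thesis
    by (simp add: walsh_coeff_def left_diff_distrib sum_subtractf diff_divide_distrib)
qed

lemma sum_Pow_insert:
  assumes "finite E" "e \<notin> E"
  shows "(\<Sum>X\<in>Pow (insert e E). f X) = (\<Sum>X\<in>Pow E. f X) + (\<Sum>X\<in>Pow E. f (insert e X))"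
proof -
  have "inj_on (insert e) (Pow E)" using assms by (auto simp: inj_on_def)
  then show ?thesis
    using assms by (subst Pow_insert, subst sum.union_disjoint) (auto simp: sum.reindex)
qed

section \<open>Low-degree polynomials and bit influences\<close>

text \<open>
  Induction on the ground set: with respect to a further element \<open>e\<close> the polynomial is \<open>Q + R\<close> or
  \<open>Q - R\<close> according to the value of that coordinate, where \<open>R\<close> has degree at most \<open>d - 1\<close>. The
  degree drop gains a factor \<open>9\<close> for the fourth moment of \<open>R\<close>, which by Cauchy-Schwarz is a factor
  \<open>3\<close> in the mixed term; it turns the binomial coefficient \<open>6\<close> into the \<open>2\<close> of a square.
\<close>

lemma bonami_low_degree:
  assumes "finite E" "\<And>S. S \<subseteq> E \<Longrightarrow> c S \<noteq> 0 \<Longrightarrow> card S \<le> d"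
  defines "P \<equiv> \<lambda>X. \<Sum>S\<in>Pow E. c S * walsh S X"
  shows "(\<Sum>X\<in>Pow E. (P X)^4) / 2 ^ card E \<le> 9 ^ d * ((\<Sum>X\<in>Pow E. (P X)\<^sup>2) / 2 ^ card E)\<^sup>2"
  using assms(1,2) unfolding P_def
proof (induction E arbitrary: c d rule: finite_induct)
  case empty
  have "(c {})^4 \<le> 9 ^ d * (c {})^4"
    by (intro mult_le_cancel_right1[THEN iffD2]) simp
  then show ?case by (simp flip: power_mult)
next
  case (insert e E)
  define Q where "Q X = (\<Sum>S\<in>Pow E. c S * walsh S X)" for X
  define R where "R X = (\<Sum>S\<in>Pow E. c (insert e S) * walsh S X)" for X
  define av where "av f = (\<Sum>X\<in>Pow E. f X) / 2 ^ card E" for f :: "'a set \<Rightarrow> real"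
  have nin: "e \<notin> S" if "S \<subseteq> E" for S using that insert.hyps(2) by auto
  have fin: "finite S" if "S \<subseteq> E" for S using that insert.hyps(1) finite_subset by auto
  have P1: "(\<Sum>S\<in>Pow (insert e E). c S * walsh S X) = Q X + R X" if "X \<subseteq> E" for X
  proof -
    have "walsh (insert e S) X = walsh S X" if "S \<subseteq> E" for S
      using nin[OF \<open>X \<subseteq> E\<close>] by (simp add: walsh_def Int_insert_left)
    then show ?thesis by (simp add: sum_Pow_insert insert Q_def R_def)
  qed
  have P2: "(\<Sum>S\<in>Pow (insert e E). c S * walsh S (insert e X)) = Q X - R X" if "X \<subseteq> E" for X
  proof -
    have "walsh S (insert e X) = walsh S X" if "S \<subseteq> E" for S
      using nin[OF that] by (simp add: walsh_def Int_insert_right)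
    moreover have "walsh (insert e S) (insert e X) = - walsh S X" if "S \<subseteq> E" for S
    proof -
      have "insert e S \<inter> insert e X = insert e (S \<inter> X)" by auto
      moreover have "card (insert e (S \<inter> X)) = Suc (card (S \<inter> X))"
        using nin[OF that] fin[OF that] by simp
      ultimately show ?thesis by (simp add: walsh_def)
    qed
    ultimately show ?thesis by (simp add: sum_Pow_insert insert Q_def R_def sum_negf)
  qed
  have split: "(\<Sum>X\<in>Pow (insert e E). (\<Sum>S\<in>Pow (insert e E). c S * walsh S X)^m) / 2 ^ card (insert e E)
      = av (\<lambda>X. ((Q X + R X)^m + (Q X - R X)^m) / 2)" for m
    using insert.hyps
    by (simp add: sum_Pow_insert[of E e "\<lambda>X. (\<Sum>S\<in>Pow (insert e E). c S * walsh S X)^m"] P1 P2 av_def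
          sum.distrib add_divide_distrib flip: sum_divide_distrib)
  have add: "av (\<lambda>X. f X + g X) = av f + av g" for f g
    by (simp add: av_def sum.distrib add_divide_distrib)
  have scale: "av (\<lambda>X. k * f X) = k * av f" for f k
    by (simp add: av_def sum_distrib_left)
  have nonneg: "av f \<ge> 0" if "\<And>X. f X \<ge> 0" for f
    unfolding av_def using that by (simp add: sum_nonneg)
  have second_moment: "av (\<lambda>X. ((Q X + R X)^2 + (Q X - R X)^2) / 2) = av (\<lambda>X. (Q X)\<^sup>2) + av (\<lambda>X. (R X)\<^sup>2)"
    unfolding add[symmetric] by (rule arg_cong[where f = av]) (auto simp: power2_eq_square field_simps)
  have fourth_moment: "av (\<lambda>X. ((Q X + R X)^4 + (Q X - R X)^4) / 2)
      = av (\<lambda>X. (Q X)^4) + 6 * av (\<lambda>X. (Q X)\<^sup>2 * (R X)\<^sup>2) + av (\<lambda>X. (R X)^4)"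
    unfolding add[symmetric] scale[symmetric]
    by (rule arg_cong[where f = av]) (auto simp: power2_eq_square power4_eq_xxxx field_simps)
  define q where "q = av (\<lambda>X. (Q X)\<^sup>2)"
  define r where "r = av (\<lambda>X. (R X)\<^sup>2)"
  have q0: "q \<ge> 0" and r0: "r \<ge> 0" unfolding q_def r_def by (auto intro: nonneg)
  have IHQ: "av (\<lambda>X. (Q X)^4) \<le> 9 ^ d * q\<^sup>2"
    unfolding q_def av_def Q_def by (rule insert.IH) (use insert.prems in auto)
  have IHR: "9 * av (\<lambda>X. (R X)^4) \<le> 9 ^ d * r\<^sup>2"
  proof (cases d)
    case 0
    have "c (insert e S) = 0" if "S \<subseteq> E" for S
      using insert.prems[of "insert e S"] that fin[OF that] 0 by auto
    then have "R = (\<lambda>X. 0)" unfolding R_def by (intro ext sum.neutral) auto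
    then show ?thesis by (simp add: av_def)
  next
    case (Suc d')
    have "av (\<lambda>X. (R X)^4) \<le> 9 ^ d' * r\<^sup>2"
      unfolding r_def av_def R_def
    proof (rule insert.IH)
      fix S assume "S \<subseteq> E" "c (insert e S) \<noteq> 0"
      then have "card (insert e S) \<le> d" by (intro insert.prems) auto
      then show "card S \<le> d'" using Suc nin fin \<open>S \<subseteq> E\<close> by simp
    qed
    then show ?thesis using Suc by simp
  qed
  have "(\<Sum>X\<in>Pow E. (Q X)\<^sup>2 * (R X)\<^sup>2)\<^sup>2 \<le> (\<Sum>X\<in>Pow E. (Q X)^4) * (\<Sum>X\<in>Pow E. (R X)^4)"
    using Cauchy_Schwarz_ineq_sum[of "\<lambda>X. (Q X)\<^sup>2" "\<lambda>X. (R X)\<^sup>2" "Pow E"] by simp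
  then have "(av (\<lambda>X. (Q X)\<^sup>2 * (R X)\<^sup>2))\<^sup>2 \<le> av (\<lambda>X. (Q X)^4) * av (\<lambda>X. (R X)^4)"
    unfolding av_def power_divide times_divide_times_eq power2_eq_square[of "2 ^ card E :: real"]
    by (rule divide_right_mono) simp
  then have "(3 * av (\<lambda>X. (Q X)\<^sup>2 * (R X)\<^sup>2))\<^sup>2 \<le> 9 * (av (\<lambda>X. (Q X)^4) * av (\<lambda>X. (R X)^4))"
    by (simp add: power_mult_distrib)
  also have "\<dots> = av (\<lambda>X. (Q X)^4) * (9 * av (\<lambda>X. (R X)^4))" by simp
  also have "\<dots> \<le> (9 ^ d * q\<^sup>2) * (9 ^ d * r\<^sup>2)"
    by (intro mult_mono IHQ IHR) (auto intro!: nonneg)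
  also have "\<dots> = (9 ^ d * (q * r))\<^sup>2" by (simp add: power_mult_distrib power2_eq_square)
  finally have cross: "3 * av (\<lambda>X. (Q X)\<^sup>2 * (R X)\<^sup>2) \<le> 9 ^ d * (q * r)"
    by (rule power2_le_imp_le) (use q0 r0 in simp)
  have R4: "av (\<lambda>X. (R X)^4) \<le> 9 ^ d * r\<^sup>2"
    using IHR nonneg[of "\<lambda>X. (R X)^4"] by simp
  have "av (\<lambda>X. (Q X)^4) + 6 * av (\<lambda>X. (Q X)\<^sup>2 * (R X)\<^sup>2) + av (\<lambda>X. (R X)^4)
      \<le> 9 ^ d * q\<^sup>2 + 2 * (9 ^ d * (q * r)) + 9 ^ d * r\<^sup>2"
    using IHQ cross R4 by linarith
  also have "\<dots> = 9 ^ d * (q + r)\<^sup>2" by (simp add: power2_eq_square algebra_simps)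
  finally show ?case
    unfolding split second_moment fourth_moment q_def r_def .
qed

definition bit_influence :: "'a set \<Rightarrow> 'a set set \<Rightarrow> 'a \<Rightarrow> real" where
  "bit_influence E B e = card {X \<in> Pow E. (X \<in> B) \<noteq> (toggle e X \<in> B)} / 2 ^ card E"

text \<open>
  This is the gain over the trivial bound by the first power of the influence. The derivative \<open>g\<close>
  takes values in \<open>{-1, 0, 1}\<close> and has second moment \<open>I\<close>. The squared norm \<open>W\<close> of its low-degree
  part \<open>h\<close> is the inner product of \<open>g\<close> and \<open>h\<close>. Two applications of Cauchy-Schwarz, in each of
  which \<open>g\<close> is split into \<open>g\<close> times an indicator of its support, reach the fourth moment of \<open>h\<close>,
  where Bonami's bound gives \<open>W^4 \<le> I^3 * 9^d * W^2\<close>.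
\<close>

lemma low_degree_influence:
  fixes B :: "'a set set"
  assumes "finite E" "e \<in> E"
  defines "f \<equiv> indicator B :: 'a set \<Rightarrow> real"
  shows "4 * (\<Sum>S | S \<subseteq> E \<and> e \<in> S \<and> card S \<le> d. (walsh_coeff E f S)\<^sup>2)
     \<le> 3 ^ d * bit_influence E B e powr (3/2)"
proof -
  define N :: real where "N = 2 ^ card E"
  have N0: "N > 0" by (simp add: N_def)
  define g where "g = (\<lambda>X. f X - f (toggle e X))"
  define c where "c S = (if e \<in> S \<and> card S \<le> d then 2 * walsh_coeff E f S else 0)" for S
  define h where "h = (\<lambda>X. \<Sum>S\<in>Pow E. c S * walsh S X)"
  define I where "I = bit_influence E B e"
  define W where "W = (\<Sum>S\<in>Pow E. (c S)\<^sup>2)"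
  have I0: "I \<ge> 0" by (simp add: I_def bit_influence_def)
  have W_eq: "W = 4 * (\<Sum>S | S \<subseteq> E \<and> e \<in> S \<and> card S \<le> d. (walsh_coeff E f S)\<^sup>2)"
  proof -
    have "W = (\<Sum>S | S \<in> Pow E \<and> (e \<in> S \<and> card S \<le> d). 4 * (walsh_coeff E f S)\<^sup>2)"
      unfolding W_def using assms(1)
      by (subst sum.inter_filter) (auto simp: c_def intro!: sum.cong)
    then show ?thesis by (simp add: sum_distrib_left)
  qed
  have W0: "W \<ge> 0" unfolding W_def by (simp add: sum_nonneg)
  have gsq: "(g X)\<^sup>2 = (if (X \<in> B) \<noteq> (toggle e X \<in> B) then 1 else 0)"
    and gabs: "\<bar>g X\<bar> = (g X)\<^sup>2" for X
    by (auto simp: g_def f_def indicator_def)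
  have gI: "(\<Sum>X\<in>Pow E. (g X)\<^sup>2) = N * I"
    using assms(1) N0 by (simp add: gsq I_def bit_influence_def N_def sum.If_cases Int_def)
  have "(\<Sum>X\<in>Pow E. g X * h X) / N = (\<Sum>S\<in>Pow E. walsh_coeff E g S * c S)"
    unfolding h_def N_def by (rule walsh_synthesis_inner[OF assms(1)])
  also have "\<dots> = W"
    unfolding W_def using assms(1,2)
    by (intro sum.cong refl) (auto simp: g_def walsh_coeff_derivative c_def power2_eq_square)
  finally have gh: "(\<Sum>X\<in>Pow E. g X * h X) = N * W" using N0 by (simp add: field_simps)
  have "(\<Sum>X\<in>Pow E. (h X)\<^sup>2) / N = W"
    unfolding N_def walsh_parseval[OF assms(1)] W_def
    using assms(1) by (intro sum.cong refl) (simp add: h_def walsh_coeff_synthesis)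
  then have h4: "(\<Sum>X\<in>Pow E. (h X)^4) \<le> N * (9 ^ d * W\<^sup>2)"
    using bonami_low_degree[OF assms(1), of c d] N0
    by (simp add: h_def N_def c_def field_simps split: if_splits)
  have "(N * W)\<^sup>2 = (\<Sum>X\<in>Pow E. g X * (g X * (g X * h X)))\<^sup>2"
    unfolding gh[symmetric]
    by (intro arg_cong[where f = "\<lambda>u. u\<^sup>2"] sum.cong refl) (auto simp: g_def f_def indicator_def)
  also have "\<dots> \<le> (\<Sum>X\<in>Pow E. (g X)\<^sup>2) * (\<Sum>X\<in>Pow E. (g X * (g X * h X))\<^sup>2)"
    by (rule Cauchy_Schwarz_ineq_sum)
  also have "(\<Sum>X\<in>Pow E. (g X * (g X * h X))\<^sup>2) = (\<Sum>X\<in>Pow E. g X * (g X * (h X)\<^sup>2))"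
    by (intro sum.cong refl) (auto simp: g_def f_def indicator_def)
  finally have c1: "(N * W)\<^sup>2 \<le> (N * I) * (\<Sum>X\<in>Pow E. g X * (g X * (h X)\<^sup>2))"
    unfolding gI .
  have "(\<Sum>X\<in>Pow E. g X * (g X * (h X)\<^sup>2))\<^sup>2 \<le> (\<Sum>X\<in>Pow E. (g X)\<^sup>2) * (\<Sum>X\<in>Pow E. (g X * (h X)\<^sup>2)\<^sup>2)"
    by (rule Cauchy_Schwarz_ineq_sum)
  also have "(\<Sum>X\<in>Pow E. (g X * (h X)\<^sup>2)\<^sup>2) \<le> (\<Sum>X\<in>Pow E. (h X)^4)"
    by (intro sum_mono) (auto simp: g_def f_def indicator_def simp flip: power_mult)
  also note h4
  finally have c2: "(\<Sum>X\<in>Pow E. g X * (g X * (h X)\<^sup>2))\<^sup>2 \<le> (N * I) * (N * (9 ^ d * W\<^sup>2))"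
    unfolding gI using N0 I0 by (simp add: mult_left_mono)
  have "((N * W)\<^sup>2)\<^sup>2 \<le> ((N * I) * (\<Sum>X\<in>Pow E. g X * (g X * (h X)\<^sup>2)))\<^sup>2"
    using c1 by (intro power_mono) auto
  also have "\<dots> \<le> (N * I)\<^sup>2 * ((N * I) * (N * (9 ^ d * W\<^sup>2)))"
    unfolding power_mult_distrib[of "N * I"] using c2 by (intro mult_left_mono) auto
  finally have "N^4 * W^4 \<le> N^4 * (9 ^ d * W\<^sup>2 * I^3)"
    by (simp add: power_mult_distrib power2_eq_square power4_eq_xxxx power3_eq_cube mult_ac)
  then have W4: "W^4 \<le> 9 ^ d * W\<^sup>2 * I^3" using N0 by simp
  have "W\<^sup>2 \<le> 9 ^ d * I^3"
  proof (cases "W = 0")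
    case False
    then have "W\<^sup>2 > 0" by simp
    moreover have "W\<^sup>2 * W\<^sup>2 \<le> W\<^sup>2 * (9 ^ d * I^3)"
      using W4 by (simp add: power2_eq_square power4_eq_xxxx mult_ac)
    ultimately show ?thesis by (rule mult_left_le_imp_le[rotated])
  qed (use I0 in simp)
  also have "\<dots> = (3 ^ d * I powr (3/2))\<^sup>2"
  proof -
    have "(I powr (3/2))\<^sup>2 = I ^ 3"
      using I0 by (cases "I = 0") (simp_all add: powr_power powr_numeral)
    moreover have "((3::real) ^ d)\<^sup>2 = 9 ^ d" by (simp add: power2_eq_square flip: power_mult_distrib)
    ultimately show ?thesis by (simp add: power_mult_distrib)
  qed
  finally have "W \<le> 3 ^ d * I powr (3/2)"
    by (rule power2_le_imp_le) simp
  then show ?thesis by (simp add: W_eq I_def)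
qed

text \<open>
  Double counting: a set contributes once for each of its elements.
\<close>

lemma sum_card_weighted:
  fixes a :: "'a set \<Rightarrow> real"
  assumes "finite E"
  shows "(\<Sum>e\<in>E. \<Sum>S | S \<subseteq> E \<and> e \<in> S \<and> Q S. a S) = (\<Sum>S | S \<subseteq> E \<and> Q S. card S * a S)"
proof -
  have fin: "finite {S. S \<subseteq> E \<and> Q S}" using assms by auto
  have "(\<Sum>e\<in>E. \<Sum>S | S \<subseteq> E \<and> e \<in> S \<and> Q S. a S)
      = (\<Sum>e\<in>E. \<Sum>S | S \<subseteq> E \<and> Q S. if e \<in> S then a S else 0)"
  proof (rule sum.cong[OF refl])
    fix e assume "e \<in> E"
    show "(\<Sum>S | S \<subseteq> E \<and> e \<in> S \<and> Q S. a S) = (\<Sum>S | S \<subseteq> E \<and> Q S. if e \<in> S then a S else 0)"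
      using fin by (subst sum.inter_filter[symmetric]) (auto intro!: sum.cong)
  qed
  also have "\<dots> = (\<Sum>S | S \<subseteq> E \<and> Q S. \<Sum>e\<in>E. if e \<in> S then a S else 0)" by (rule sum.swap)
  also have "\<dots> = (\<Sum>S | S \<subseteq> E \<and> Q S. card S * a S)"
  proof (intro sum.cong refl)
    fix S assume "S \<in> {S. S \<subseteq> E \<and> Q S}"
    then have "{e \<in> E. e \<in> S} = S" by auto
    then show "(\<Sum>e\<in>E. if e \<in> S then a S else 0) = card S * a S"
      using assms by (simp flip: sum.inter_filter)
  qed
  finally show ?thesis .
qed

text \<open>
  A Walsh level \<open>j\<close> is counted \<open>j\<close> times in the total influence, so the levels above \<open>d\<close> have
  weight at most the total influence divided by \<open>d + 1\<close>. The levels from \<open>1\<close> to \<open>d\<close> are covered by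
  the low-degree parts of the derivatives.
\<close>

theorem kkl_inequality:
  fixes B :: "'a set set"
  assumes "finite E" "B \<subseteq> Pow E"
  defines "a \<equiv> card B / 2 ^ card E :: real"
  shows "4 * (a * (1 - a)) \<le> 3 ^ d * (\<Sum>e\<in>E. bit_influence E B e powr (3/2))
           + (\<Sum>e\<in>E. bit_influence E B e) / (real d + 1)"
proof -
  define f where "f = (indicator B :: 'a set \<Rightarrow> real)"
  define w where "w S = (walsh_coeff E f S)\<^sup>2" for S
  have w0: "w S \<ge> 0" for S by (simp add: w_def)
  have fin: "finite {S. S \<subseteq> E \<and> Q S}" for Q using assms(1) by auto
  have cardB: "(\<Sum>X\<in>Pow E. f X) = card B"
    using assms(1,2) by (simp add: f_def indicator_def sum.If_cases Int_absorb1)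
  have total: "(\<Sum>S\<in>Pow E. w S) = a"
    unfolding w_def walsh_parseval[OF assms(1), symmetric] a_def cardB[symmetric]
    by (intro arg_cong2[where f = "(/)"] sum.cong refl) (simp add: f_def indicator_def)
  have w_empty: "w {} = a\<^sup>2"
    by (simp add: w_def walsh_coeff_def cardB a_def)
  have deriv: "4 * (\<Sum>S | S \<subseteq> E \<and> e \<in> S \<and> True. w S) = bit_influence E B e" if "e \<in> E" for e
  proof -
    have "4 * (\<Sum>S | S \<subseteq> E \<and> e \<in> S \<and> True. w S)
        = (\<Sum>S\<in>Pow E. (walsh_coeff E (\<lambda>X. f X - f (toggle e X)) S)\<^sup>2)"
    proof -
      have "(\<Sum>S | S \<in> Pow E \<and> e \<in> S. 4 * w S) = (\<Sum>S\<in>Pow E. if e \<in> S then 4 * w S else 0)"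
        using assms(1) by (intro sum.inter_filter) auto
      also have "\<dots> = (\<Sum>S\<in>Pow E. (walsh_coeff E (\<lambda>X. f X - f (toggle e X)) S)\<^sup>2)"
        using assms(1) that
        by (intro sum.cong refl) (auto simp: walsh_coeff_derivative w_def power_mult_distrib)
      finally show ?thesis by (simp add: sum_distrib_left)
    qed
    also have "\<dots> = (\<Sum>X\<in>Pow E. (f X - f (toggle e X))\<^sup>2) / 2 ^ card E"
      by (rule walsh_parseval[OF assms(1), symmetric])
    also have "(\<Sum>X\<in>Pow E. (f X - f (toggle e X))\<^sup>2)
        = (\<Sum>X\<in>Pow E. if (X \<in> B) \<noteq> (toggle e X \<in> B) then 1 else 0)"
      by (intro sum.cong refl) (auto simp: f_def indicator_def)
    also have "\<dots> = card {X \<in> Pow E. (X \<in> B) \<noteq> (toggle e X \<in> B)}"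
      using assms(1) by (simp add: sum.If_cases Int_def)
    finally show ?thesis by (simp add: bit_influence_def)
  qed
  have "a * (1 - a) = (\<Sum>S\<in>Pow E - {{}}. w S)"
    using total w_empty assms(1) sum.remove[of "Pow E" "{}" w]
    by (simp add: power2_eq_square algebra_simps)
  also have "\<dots> \<le> (\<Sum>S\<in>Pow E - {{}}. (if card S \<le> d then card S * w S else 0) + card S * w S / (real d + 1))"
  proof (rule sum_mono)
    fix S assume S: "S \<in> Pow E - {{}}"
    then have "card S \<ge> 1" using assms(1) finite_subset card_gt_0_iff
      by (metis DiffE PowD Suc_leI empty_iff insertI1 One_nat_def insert_iff)
    show "w S \<le> (if card S \<le> d then card S * w S else 0) + card S * w S / (real d + 1)"
    proof (cases "card S \<le> d")
      case True
      have "w S * 1 \<le> w S * card S" using \<open>card S \<ge> 1\<close> w0 by (intro mult_left_mono) auto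
      moreover have "0 \<le> card S * w S / (real d + 1)" using w0[of S] by simp
      ultimately show ?thesis using True by (simp add: mult.commute)
    next
      case False
      then have "w S * (d + 1) \<le> w S * card S" using w0 by (intro mult_left_mono) auto
      then show ?thesis using False by (simp add: field_simps)
    qed
  qed
  also have "\<dots> \<le> (\<Sum>S\<in>Pow E. (if card S \<le> d then card S * w S else 0) + card S * w S / (real d + 1))"
    using assms(1) w0 by (intro sum_mono2) auto
  also have "\<dots> = (\<Sum>S | S \<subseteq> E \<and> card S \<le> d. card S * w S) + (\<Sum>S | S \<subseteq> E \<and> True. card S * w S) / (real d + 1)"
    using assms(1)
    by (simp add: sum.distrib sum.If_cases Int_def Pow_def flip: sum_divide_distrib)
  also have "\<dots> = (\<Sum>e\<in>E. \<Sum>S | S \<subseteq> E \<and> e \<in> S \<and> card S \<le> d. w S)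
       + (\<Sum>e\<in>E. \<Sum>S | S \<subseteq> E \<and> e \<in> S \<and> True. w S) / (real d + 1)"
    unfolding sum_card_weighted[OF assms(1)] ..
  finally have "4 * (a * (1 - a)) \<le> (\<Sum>e\<in>E. 4 * (\<Sum>S | S \<subseteq> E \<and> e \<in> S \<and> card S \<le> d. w S))
       + (\<Sum>e\<in>E. 4 * (\<Sum>S | S \<subseteq> E \<and> e \<in> S \<and> True. w S)) / (real d + 1)"
    unfolding sum_distrib_left[symmetric] by argo
  also have "(\<Sum>e\<in>E. 4 * (\<Sum>S | S \<subseteq> E \<and> e \<in> S \<and> True. w S)) = (\<Sum>e\<in>E. bit_influence E B e)"
    by (intro sum.cong refl deriv)
  also have "(\<Sum>e\<in>E. 4 * (\<Sum>S | S \<subseteq> E \<and> e \<in> S \<and> card S \<le> d. w S))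
      \<le> (\<Sum>e\<in>E. 3 ^ d * bit_influence E B e powr (3/2))"
    unfolding w_def f_def by (intro sum_mono low_degree_influence assms(1))
  finally show ?thesis by (simp add: sum_distrib_left add.commute)
qed

section \<open>Fibres of subsets of a grid\<close>

definition grid :: "'i set \<Rightarrow> nat \<Rightarrow> ('i \<Rightarrow> nat) set" where
  "grid I M = PiE I (\<lambda>_. {..<M})"

definition fibre_count :: "nat \<Rightarrow> ('i \<Rightarrow> nat) set \<Rightarrow> 'i \<Rightarrow> ('i \<Rightarrow> nat) \<Rightarrow> nat" where
  "fibre_count M A i b = card {k. k < M \<and> b(i := k) \<in> A}"

lemma finite_grid: "finite I \<Longrightarrow> finite (grid I M)"
  by (simp add: grid_def finite_PiE)

lemma card_grid: "finite I \<Longrightarrow> card (grid I M) = M ^ card I"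
  by (simp add: grid_def card_PiE)

lemma grid_upd: "b \<in> grid I M \<Longrightarrow> i \<in> I \<Longrightarrow> k < M \<Longrightarrow> b(i := k) \<in> grid I M"
  by (auto simp: grid_def PiE_iff extensional_def)

lemma grid_less: "b \<in> grid I M \<Longrightarrow> i \<in> I \<Longrightarrow> b i < M"
  by (auto simp: grid_def)

lemma fibre_count_le: "fibre_count M A i b \<le> M"
  unfolding fibre_count_def by (rule order_trans[OF card_mono[of "{..<M}"]]) auto

lemma fibre_count_upd [simp]: "fibre_count M A i (b(i := k)) = fibre_count M A i b"
  by (simp add: fibre_count_def)

text \<open>
  Resampling one coordinate uniformly preserves the uniform distribution on the grid. This is what
  allows every average over the grid to be computed fibre by fibre.
\<close>

lemma sum_grid_resample:
  fixes G :: "('i \<Rightarrow> nat) \<Rightarrow> real"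
  assumes "finite I" "i \<in> I"
  shows "(\<Sum>b\<in>grid I M. \<Sum>k<M. G (b(i := k))) = M * (\<Sum>b\<in>grid I M. G b)"
proof -
  have "(\<Sum>b\<in>grid I M. \<Sum>k<M. G (b(i := k))) = (\<Sum>(b,k)\<in>grid I M \<times> {..<M}. G (b(i := k)))"
    by (rule sum.cartesian_product)
  also have "\<dots> = (\<Sum>(b,k)\<in>grid I M \<times> {..<M}. G b)"
    by (rule sum.reindex_bij_witness[where i = "\<lambda>(b,k). (b(i := k), b i)" and j = "\<lambda>(b,k). (b(i := k), b i)"])
       (use assms in \<open>auto simp: grid_upd grid_less\<close>)
  also have "\<dots> = (\<Sum>b\<in>grid I M. \<Sum>k<M. G b)"
    by (rule sum.cartesian_product[symmetric])
  finally show ?thesis by (simp add: sum_distrib_left)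
qed

lemma card_eq_sum_ind: "finite S \<Longrightarrow> real (card {x \<in> S. P x}) = (\<Sum>x\<in>S. if P x then 1 else 0)"
  by (simp add: sum.If_cases Int_def)

lemma fibre_count_sum: "real (fibre_count M A i b) = (\<Sum>k<M. if b(i := k) \<in> A then 1 else 0)"
  using card_eq_sum_ind[of "{..<M}" "\<lambda>k. b(i := k) \<in> A"] by (simp add: fibre_count_def)

lemma sum_fibre_count:
  assumes "finite I" "i \<in> I" "A \<subseteq> grid I M"
  shows "(\<Sum>b\<in>grid I M. real (fibre_count M A i b)) = real M * real (card A)"
proof -
  have "(\<Sum>b\<in>grid I M. real (fibre_count M A i b)) = real M * (\<Sum>b\<in>grid I M. if b \<in> A then 1 else 0)"
    unfolding fibre_count_sum by (rule sum_grid_resample[OF assms(1,2)])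
  also have "(\<Sum>b\<in>grid I M. if b \<in> A then 1 else 0 :: real) = card A"
    using assms finite_grid[OF assms(1), of M] by (simp add: sum.If_cases Int_absorb1)
  finally show ?thesis .
qed

section \<open>Compression to down-sets\<close>

text \<open>
  Sorting the columns of a zero-one matrix spreads its row sums. The rows with sum above \<open>c\<close>,
  \<open>card T\<close> in number, contain at most \<open>min (r l) (card T)\<close> ones of column \<open>l\<close>, and this is the
  exact number of ones of that column in the first \<open>card T\<close> rows after sorting.
\<close>

lemma sorted_rows_majorize:
  fixes a :: "nat \<Rightarrow> nat \<Rightarrow> bool" and M :: nat and c :: real
  defines "s \<equiv> \<lambda>k. card {l. l < M \<and> a k l}" and "r \<equiv> \<lambda>l. card {k. k < M \<and> a k l}"
  shows "(\<Sum>k<M. max 0 (real (s k) - c)) \<le> (\<Sum>k<M. max 0 (real (card {l. l < M \<and> k < r l}) - c))"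
proof -
  define T where "T = {k\<in>{..<M}. real (s k) > c}"
  have T: "T \<subseteq> {..<M}" "finite T" by (auto simp: T_def)
  then have cT: "card T \<le> M" using card_mono[of "{..<M}" T] by simp
  have "(\<Sum>k<M. max 0 (real (s k) - c)) = (\<Sum>k\<in>T. real (s k) - c)"
    unfolding T_def by (subst sum.inter_filter) (auto intro!: sum.cong)
  also have "\<dots> = (\<Sum>k\<in>T. \<Sum>l<M. if a k l then 1 else 0) - card T * c"
    by (simp add: sum_subtractf s_def card_eq_sum_ind[of "{..<M}", simplified])
  also have "(\<Sum>k\<in>T. \<Sum>l<M. if a k l then 1 else 0 :: real) = (\<Sum>l<M. \<Sum>k\<in>T. if a k l then 1 else 0)"
    by (rule sum.swap)
  also have "\<dots> \<le> (\<Sum>l<M. \<Sum>k<card T. if k < r l then 1 else 0)"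
  proof (rule sum_mono)
    fix l
    have "card {k \<in> T. a k l} \<le> r l"
      unfolding r_def using T by (intro card_mono) auto
    moreover have "card {k \<in> T. a k l} \<le> card T" using T by (intro card_mono) auto
    moreover have "{k \<in> {..<card T}. k < r l} = {..<min (card T) (r l)}" by auto
    ultimately show "(\<Sum>k\<in>T. if a k l then 1 else 0) \<le> (\<Sum>k<card T. if k < r l then 1 else 0 :: real)"
      using T card_eq_sum_ind[of T "\<lambda>k. a k l"] card_eq_sum_ind[of "{..<card T}" "\<lambda>k. k < r l"]
      by simp
  qed
  also have "\<dots> = (\<Sum>k<card T. \<Sum>l<M. if k < r l then 1 else 0)" by (rule sum.swap)
  also have "\<dots> - card T * c = (\<Sum>k<card T. real (card {l. l < M \<and> k < r l}) - c)"
    by (simp add: sum_subtractf card_eq_sum_ind[of "{..<M}", simplified])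
  also have "\<dots> \<le> (\<Sum>k<card T. max 0 (real (card {l. l < M \<and> k < r l}) - c))"
    by (intro sum_mono) simp
  also have "\<dots> \<le> (\<Sum>k<M. max 0 (real (card {l. l < M \<and> k < r l}) - c))"
    using cT by (intro sum_mono2) auto
  finally show ?thesis by simp
qed

definition down_in :: "('i \<Rightarrow> nat) set \<Rightarrow> 'i \<Rightarrow> bool" where
  "down_in A i \<longleftrightarrow> (\<forall>b\<in>A. \<forall>k\<le>b i. b(i := k) \<in> A)"

definition compress :: "'i set \<Rightarrow> nat \<Rightarrow> 'i \<Rightarrow> ('i \<Rightarrow> nat) set \<Rightarrow> ('i \<Rightarrow> nat) set" where
  "compress I M i A = {b \<in> grid I M. b i < fibre_count M A i b}"

lemma fibre_count_compress_self:
  assumes "b \<in> grid I M" "i \<in> I"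
  shows "fibre_count M (compress I M i A) i b = fibre_count M A i b"
proof -
  have "{k. k < M \<and> b(i := k) \<in> compress I M i A} = {..<fibre_count M A i b}"
    using assms fibre_count_le[of M A i b] by (auto simp: compress_def grid_upd)
  then show ?thesis by (simp add: fibre_count_def)
qed

lemma card_compress:
  assumes "finite I" "i \<in> I" "A \<subseteq> grid I M" "M > 0"
  shows "card (compress I M i A) = card A"
proof -
  have "M * real (card (compress I M i A)) = (\<Sum>b\<in>grid I M. real (fibre_count M (compress I M i A) i b))"
    using assms by (subst sum_fibre_count) (auto simp: compress_def)
  also have "\<dots> = (\<Sum>b\<in>grid I M. real (fibre_count M A i b))"
    using assms by (intro sum.cong refl) (simp add: fibre_count_compress_self)
  also have "\<dots> = M * real (card A)" using assms by (subst sum_fibre_count) auto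
  finally show ?thesis using assms by simp
qed

text \<open>
  If all coordinates other than \<open>i\<close> and \<open>j\<close> are fixed, the set becomes a zero-one matrix, and the
  compression sorts its columns. Hinge functions \<open>max 0 (x - c)\<close> suffice to describe the majorization.
\<close>

lemma compress_majorizes:
  assumes "finite I" "i \<in> I" "j \<in> I" "A \<subseteq> grid I M" "M > 0"
  shows "(\<Sum>b\<in>grid I M. max 0 (real (fibre_count M A j b) - c))
       \<le> (\<Sum>b\<in>grid I M. max 0 (real (fibre_count M (compress I M i A) j b) - c))"
proof (cases "i = j")
  case True
  then show ?thesis using assms by (intro sum_mono) (simp add: fibre_count_compress_self)
next
  case False
  have "M * (\<Sum>b\<in>grid I M. max 0 (real (fibre_count M A j b) - c))
      = (\<Sum>b\<in>grid I M. \<Sum>k<M. max 0 (real (fibre_count M A j (b(i := k))) - c))"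
    by (rule sum_grid_resample[OF assms(1,2), symmetric])
  also have "\<dots> \<le> (\<Sum>b\<in>grid I M. \<Sum>k<M. max 0 (real (fibre_count M (compress I M i A) j (b(i := k))) - c))"
  proof (rule sum_mono)
    fix b assume b: "b \<in> grid I M"
    define a where "a k l \<longleftrightarrow> b(i := k, j := l) \<in> A" for k l
    have r: "fibre_count M A i (b(i := k, j := l)) = card {k. k < M \<and> a k l}" for k l
      using False by (simp add: fibre_count_def a_def fun_upd_twist)
    have "fibre_count M (compress I M i A) j (b(i := k)) = card {l. l < M \<and> k < card {k. k < M \<and> a k l}}"
      if "k < M" for k
    proof -
      have "(b(i := k))(j := l) \<in> compress I M i A \<longleftrightarrow> k < card {k. k < M \<and> a k l}" if "l < M" for l
        using b \<open>k < M\<close> that assms(2,3) False unfolding compress_def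
        by (simp add: grid_upd r)
      then show ?thesis unfolding fibre_count_def by (intro arg_cong[where f = card]) auto
    qed
    moreover have "fibre_count M A j (b(i := k)) = card {l. l < M \<and> a k l}" for k
      by (simp add: fibre_count_def a_def)
    ultimately show "(\<Sum>k<M. max 0 (real (fibre_count M A j (b(i := k))) - c))
        \<le> (\<Sum>k<M. max 0 (real (fibre_count M (compress I M i A) j (b(i := k))) - c))"
      using sorted_rows_majorize[of M a c] by simp
  qed
  also have "\<dots> = M * (\<Sum>b\<in>grid I M. max 0 (real (fibre_count M (compress I M i A) j b) - c))"
    by (rule sum_grid_resample[OF assms(1,2)])
  finally show ?thesis using assms(5) by simp
qed

lemma down_in_compress_self: "i \<in> I \<Longrightarrow> down_in (compress I M i A) i"
  unfolding down_in_def compress_def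
  by (auto intro!: grid_upd dest: grid_less)

lemma down_in_compress_other:
  assumes "down_in A j" "i \<noteq> j" "j \<in> I"
  shows "down_in (compress I M i A) j"
  unfolding down_in_def
proof (intro ballI allI impI)
  fix b k assume b: "b \<in> compress I M i A" and k: "k \<le> b j"
  have "fibre_count M A i b \<le> fibre_count M A i (b(j := k))"
    unfolding fibre_count_def
  proof (intro card_mono)
    show "{l. l < M \<and> b(i := l) \<in> A} \<subseteq> {l. l < M \<and> b(j := k, i := l) \<in> A}"
    proof clarify
      fix l assume "b(i := l) \<in> A"
      then have "(b(i := l))(j := k) \<in> A" using assms k by (auto simp: down_in_def)
      then show "b(j := k, i := l) \<in> A" using assms(2) by (simp add: fun_upd_twist)
    qed
  qed auto
  then show "b(j := k) \<in> compress I M i A"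
    using b k assms(2,3) by (auto simp: compress_def intro!: grid_upd dest: grid_less)
qed

text \<open>
  A compression preserves monotonicity in the other directions (\<open>down_in_compress_other\<close>), so
  one compression for each direction is enough.
\<close>

lemma exists_down_set:
  assumes "finite I" "A \<subseteq> grid I M" "M > 0"
  shows "\<exists>A'\<subseteq>grid I M. card A' = card A \<and> (\<forall>i\<in>I. down_in A' i) \<and>
    (\<forall>i\<in>I. \<forall>c. (\<Sum>b\<in>grid I M. max 0 (real (fibre_count M A i b) - c))
       \<le> (\<Sum>b\<in>grid I M. max 0 (real (fibre_count M A' i b) - c)))"
proof -
  have "\<exists>A'\<subseteq>grid I M. card A' = card A \<and> (\<forall>i\<in>T. down_in A' i) \<and>
    (\<forall>i\<in>I. \<forall>c. (\<Sum>b\<in>grid I M. max 0 (real (fibre_count M A i b) - c))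
       \<le> (\<Sum>b\<in>grid I M. max 0 (real (fibre_count M A' i b) - c)))" if "finite T" "T \<subseteq> I" for T
    using that
  proof (induction T rule: finite_induct)
    case empty
    then show ?case using assms(2) by auto
  next
    case (insert j T)
    then obtain A' where A': "A' \<subseteq> grid I M" "card A' = card A" "\<forall>i\<in>T. down_in A' i"
      and maj: "\<And>i c. i \<in> I \<Longrightarrow> (\<Sum>b\<in>grid I M. max 0 (real (fibre_count M A i b) - c))
       \<le> (\<Sum>b\<in>grid I M. max 0 (real (fibre_count M A' i b) - c))" by blast
    have j: "j \<in> I" using insert by auto
    show ?case
    proof (intro exI[of _ "compress I M j A'"] conjI ballI allI)
      show "compress I M j A' \<subseteq> grid I M" by (auto simp: compress_def)
      show "card (compress I M j A') = card A"
        using card_compress[OF assms(1) j A'(1) assms(3)] A'(2) by simp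
    next
      fix i assume "i \<in> insert j T"
      then show "down_in (compress I M j A') i"
        using A'(3) insert.prems insert.hyps down_in_compress_self[OF j]
        by (cases "i = j") (auto intro!: down_in_compress_other)
    next
      fix i c assume "i \<in> I"
      then show "(\<Sum>b\<in>grid I M. max 0 (real (fibre_count M A i b) - c))
       \<le> (\<Sum>b\<in>grid I M. max 0 (real (fibre_count M (compress I M j A') i b) - c))"
        using maj[of i c] compress_majorizes[OF assms(1) j _ A'(1) assms(3), of i c] by linarith
    qed
  qed
  from this[OF assms(1) order_refl] show ?thesis .
qed

section \<open>Binary digits of initial segments\<close>

definition capped :: "real \<Rightarrow> real \<Rightarrow> real" where
  "capped c t = min c (min t (1 - t))"

text \<open>
  An affine function minus two hinges, which is the form in which majorization can be applied.
\<close>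

lemma capped_as_hinges:
  assumes "c \<le> 1/2"
  shows "capped c t = t - max 0 (t - c) - max 0 (t - (1 - c))"
  using assms by (auto simp: capped_def min_def max_def)

lemma fibre_count_down:
  assumes "A \<subseteq> grid I M" "i \<in> I" "down_in A i" "b \<in> grid I M" "k < M"
  shows "b(i := k) \<in> A \<longleftrightarrow> k < fibre_count M A i b"
proof -
  define S where "S = {k. k < M \<and> b(i := k) \<in> A}"
  have dn: "l \<in> S" if "k \<in> S" "l \<le> k" for k l
    using that assms(3) unfolding S_def down_in_def by (fastforce dest: bspec[of _ _ "b(i := k)"])
  have fin: "finite S" by (simp add: S_def)
  have "S = {..<card S}"
  proof (cases "S = {}")
    case False
    have "S = {..Max S}"
      using Max_ge[OF fin] dn[OF Max_in[OF fin False]] by auto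
    then show ?thesis by (metis card_atMost lessThan_Suc_atMost)
  qed auto
  then show ?thesis using assms(5) unfolding fibre_count_def S_def by blast
qed

definition flip_at :: "nat \<Rightarrow> nat \<Rightarrow> nat" where
  "flip_at k v = set_encode (toggle k (set_decode v))"

lemma finite_toggle [simp]: "finite (toggle e X) = finite X"
  by (simp add: toggle_def)

lemma flip_at_flip_at [simp]: "flip_at k (flip_at k v) = v"
  by (simp add: flip_at_def finite_set_decode)

lemma flip_at_cases: "flip_at k v = v + 2 ^ k \<or> v = flip_at k v + 2 ^ k"
proof (cases "k \<in> set_decode v")
  case True
  then have "set_encode (insert k (set_decode v - {k})) = v"
    by (simp add: insert_absorb)
  moreover have "set_encode (insert k (set_decode v - {k})) = 2 ^ k + set_encode (set_decode v - {k})"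
    by (rule set_encode_insert) (auto simp: finite_set_decode)
  ultimately have "v = flip_at k v + 2 ^ k"
    unfolding flip_at_def toggle_def using True by presburger
  then show ?thesis ..
next
  case False
  then show ?thesis by (simp add: flip_at_def toggle_def finite_set_decode)
qed

lemma bij_betw_set_encode: "bij_betw set_encode (Pow {..<K}) {..<2 ^ K}"
proof -
  have inj: "inj_on set_encode (Pow {..<K})"
    by (rule inj_on_subset[OF inj_on_set_encode]) (auto intro: finite_subset)
  have "set_encode S < 2 ^ K" if "S \<subseteq> {..<K}" for S
  proof -
    have "set_encode S \<le> (\<Sum>k<K. 2 ^ k)" unfolding set_encode_def using that by (intro sum_mono2) auto
    also have "\<dots> < 2 ^ K" by (induction K) auto
    finally show ?thesis .
  qed
  then have "set_encode ` Pow {..<K} \<subseteq> {..<2 ^ K}" by auto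
  moreover have "card (set_encode ` Pow {..<K}) = card {..<2 ^ K :: nat}"
    using inj by (simp add: card_image card_Pow)
  ultimately have "set_encode ` Pow {..<K} = {..<2 ^ K}" by (intro card_subset_eq) auto
  then show ?thesis using inj by (simp add: bij_betw_def)
qed

lemma flip_at_less:
  assumes "k < K" "v < 2 ^ K"
  shows "flip_at k v < 2 ^ K"
proof -
  obtain S where "S \<subseteq> {..<K}" "v = set_encode S"
    using bij_betw_set_encode[of K] assms(2) by (auto simp: bij_betw_def)
  then have "set_decode v \<subseteq> {..<K}" using finite_subset[of S "{..<K}"] by simp
  then have "toggle k (set_decode v) \<in> Pow {..<K}" using assms by (intro toggle_in_Pow) auto
  then show ?thesis using bij_betw_set_encode[of K] unfolding flip_at_def bij_betw_def by blast
qed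

text \<open>
  The flip exchanges the points that leave the segment \<open>{..<r}\<close> with those that enter it, whence the
  factor \<open>2\<close>. A point that leaves is moved up by \<open>2^k\<close> across \<open>r\<close>: it is one of the last \<open>2^k\<close>
  elements of the segment, and its image is one of the \<open>2^K - r\<close> points outside.
\<close>

lemma threshold_bit_influence:
  assumes "k < K" "r \<le> 2 ^ K"
  shows "real (card {v. v < 2 ^ K \<and> (v < r) \<noteq> (flip_at k v < r)})
     \<le> 2 * min (2 ^ k) (min (real r) (2 ^ K - real r))"
proof -
  define U where "U = {v. v < r \<and> \<not> flip_at k v < r}"
  have finU: "finite U" by (simp add: U_def)
  have "{v. v < 2 ^ K \<and> (v < r) \<noteq> (flip_at k v < r)} \<subseteq> U \<union> flip_at k ` U"
  proof
    fix v assume v: "v \<in> {v. v < 2 ^ K \<and> (v < r) \<noteq> (flip_at k v < r)}"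
    show "v \<in> U \<union> flip_at k ` U"
    proof (cases "v < r")
      case False
      then have "flip_at k v \<in> U" using v by (auto simp: U_def)
      then show ?thesis by (metis UnI2 flip_at_flip_at image_eqI)
    qed (use v in \<open>auto simp: U_def\<close>)
  qed
  then have "card {v. v < 2 ^ K \<and> (v < r) \<noteq> (flip_at k v < r)} \<le> card (U \<union> flip_at k ` U)"
    using finU by (intro card_mono) auto
  also have "\<dots> \<le> card U + card U"
    by (rule order_trans[OF card_Un_le]) (use finU card_image_le in auto)
  finally have le: "card {v. v < 2 ^ K \<and> (v < r) \<noteq> (flip_at k v < r)} \<le> 2 * card U" by simp
  have "U \<subseteq> {..<r}" by (auto simp: U_def)
  then have c1: "card U \<le> r" using card_mono[of "{..<r}" U] by simp
  have "v \<in> {r - 2 ^ k..<r}" if "v \<in> U" for v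
    using that flip_at_cases[of k v] by (auto simp: U_def)
  then have "U \<subseteq> {r - 2 ^ k..<r}" by blast
  then have c2: "card U \<le> 2 ^ k" using card_mono[of "{r - 2 ^ k..<r}" U] by simp
  have "flip_at k ` U \<subseteq> {r..<2 ^ K}"
    using assms by (auto simp: U_def intro!: flip_at_less)
  then have "card (flip_at k ` U) \<le> 2 ^ K - r" using card_mono[of "{r..<2 ^ K}" "flip_at k ` U"] by simp
  moreover have "inj_on (flip_at k) U" by (metis flip_at_flip_at inj_onI)
  ultimately have c3: "card U \<le> 2 ^ K - r" by (simp add: card_image)
  have "real (card U) \<le> min (2 ^ k) (min (real r) (2 ^ K - real r))"
  proof (intro min.boundedI)
    show "real (card U) \<le> 2 ^ k" using of_nat_mono[OF c2, where 'a = real] by simp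
    show "real (card U) \<le> 2 ^ K - real r"
    proof -
      have "card U + r \<le> 2 ^ K" using c3 assms(2) by linarith
      from of_nat_mono[OF this, where 'a = real] show ?thesis by simp
    qed
  qed (use c1 in simp)
  moreover have "real (card {v. v < 2 ^ K \<and> (v < r) \<noteq> (flip_at k v < r)}) \<le> 2 * real (card U)"
    using of_nat_mono[OF le, where 'a = real] by simp
  ultimately show ?thesis by (meson mult_left_mono order_trans zero_le_numeral)
qed

section \<open>From the cube to the grid\<close>

definition bits_to_point :: "'i set \<Rightarrow> ('i \<times> nat) set \<Rightarrow> 'i \<Rightarrow> nat" where
  "bits_to_point I X = (\<lambda>i\<in>I. set_encode {k. (i, k) \<in> X})"

lemma bij_betw_bits_to_point:
  assumes "finite I"
  shows "bij_betw (bits_to_point I) (Pow (I \<times> {..<K})) (grid I (2 ^ K))"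
proof -
  have slice: "{k. (i, k) \<in> X} \<in> Pow {..<K}" if "X \<in> Pow (I \<times> {..<K})" for i X
    using that by auto
  then have fin: "finite {k. (i, k) \<in> X}" if "X \<in> Pow (I \<times> {..<K})" for i X
    using that by (meson PowD finite_lessThan finite_subset)
  have inj: "inj_on (bits_to_point I) (Pow (I \<times> {..<K}))"
  proof (rule inj_onI)
    fix X Y assume X: "X \<in> Pow (I \<times> {..<K})" and Y: "Y \<in> Pow (I \<times> {..<K})"
      and eq: "bits_to_point I X = bits_to_point I Y"
    have "{k. (i, k) \<in> X} = {k. (i, k) \<in> Y}" if "i \<in> I" for i
    proof -
      have "set_encode {k. (i, k) \<in> X} = set_encode {k. (i, k) \<in> Y}"
        using fun_cong[OF eq, of i] that by (simp add: bits_to_point_def)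
      then show ?thesis using set_encode_eq[OF fin[OF X] fin[OF Y]] by simp
    qed
    then have "(i, k) \<in> X \<longleftrightarrow> (i, k) \<in> Y" if "i \<in> I" for i k using that by blast
    then show "X = Y" using X Y by auto
  qed
  have "set_encode {k. (i, k) \<in> X} < 2 ^ K" if "X \<subseteq> I \<times> {..<K}" for i X
    using bij_betw_apply[OF bij_betw_set_encode slice, of X i] that by auto
  then have "bits_to_point I ` Pow (I \<times> {..<K}) \<subseteq> grid I (2 ^ K)"
    by (auto simp: bits_to_point_def grid_def)
  moreover have "card (bits_to_point I ` Pow (I \<times> {..<K})) = card (grid I (2 ^ K))"
    using inj assms
    by (simp add: card_image card_Pow card_grid card_cartesian_product power_mult mult.commute)
  ultimately show ?thesis
    unfolding bij_betw_def using card_subset_eq[OF finite_grid[OF assms]] inj by blast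
qed

lemma bits_to_point_toggle:
  assumes "X \<subseteq> I \<times> {..<K}" "i \<in> I"
  shows "bits_to_point I (toggle (i, k) X) = (bits_to_point I X)(i := flip_at k (bits_to_point I X i))"
proof
  fix j
  have "{l. (i, l) \<in> X} \<subseteq> {..<K}" using assms by auto
  then have "finite {l. (i, l) \<in> X}" using finite_subset by blast
  moreover have "{l. (i, l) \<in> toggle (i, k) X} = toggle k {l. (i, l) \<in> X}"
    by (auto simp: toggle_def)
  moreover have "{l. (j, l) \<in> toggle (i, k) X} = {l. (j, l) \<in> X}" if "j \<noteq> i"
    using that by (auto simp: toggle_def)
  ultimately show "bits_to_point I (toggle (i, k) X) j
      = ((bits_to_point I X)(i := flip_at k (bits_to_point I X i))) j"
    using assms(2) by (auto simp: bits_to_point_def flip_at_def)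
qed

text \<open>
  The bit \<open>(i, k)\<close> only moves the point inside its fibre in direction \<open>i\<close>, and the fibres of a
  down-set are initial segments; the bound is the mean over the fibres of the one for segments.
\<close>

lemma down_set_bit_influence:
  assumes "finite I" "i \<in> I" "k < K" "A \<subseteq> grid I (2 ^ K)" "down_in A i"
  shows "bit_influence (I \<times> {..<K}) {X \<in> Pow (I \<times> {..<K}). bits_to_point I X \<in> A} (i, k)
     \<le> 2 / card (grid I (2 ^ K)) *
        (\<Sum>b\<in>grid I (2 ^ K). capped (2 ^ k / 2 ^ K) (fibre_count (2 ^ K) A i b / 2 ^ K))"
proof -
  define M :: nat where "M = 2 ^ K"
  define E where "E = I \<times> {..<K}"
  define G where "G = grid I M"
  define f where "f b = (if (b \<in> A) \<noteq> (b(i := flip_at k (b i)) \<in> A) then 1 else 0 :: real)" for b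
  have M0: "real M > 0" by (simp add: M_def)
  have e: "(i, k) \<in> E" using assms by (simp add: E_def)
  have finE: "finite E" using assms by (simp add: E_def)
  have cardE: "2 ^ card E = real (card G)"
    using bij_betw_same_card[OF bij_betw_bits_to_point[OF assms(1), of K]] finE
    by (simp add: E_def G_def M_def card_Pow flip: of_nat_power)
  have "bit_influence E {X \<in> Pow E. bits_to_point I X \<in> A} (i, k)
      = (\<Sum>X\<in>Pow E. f (bits_to_point I X)) / card G"
  proof -
    have "real (card {X \<in> Pow E. (X \<in> {X \<in> Pow E. bits_to_point I X \<in> A})
            \<noteq> (toggle (i, k) X \<in> {X \<in> Pow E. bits_to_point I X \<in> A})})
        = (\<Sum>X\<in>Pow E. f (bits_to_point I X))"
      unfolding card_eq_sum_ind[OF finite_Pow_iff[THEN iffD2, OF finE]]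
    proof (rule sum.cong[OF refl])
      fix X assume X: "X \<in> Pow E"
      then have "toggle (i, k) X \<in> Pow E" using e by (rule toggle_in_Pow[rotated])
      moreover have "bits_to_point I (toggle (i, k) X)
          = (bits_to_point I X)(i := flip_at k (bits_to_point I X i))"
        using X assms(2) by (intro bits_to_point_toggle) (auto simp: E_def)
      ultimately show "(if (X \<in> {X \<in> Pow E. bits_to_point I X \<in> A})
            \<noteq> (toggle (i, k) X \<in> {X \<in> Pow E. bits_to_point I X \<in> A}) then 1 else 0)
          = f (bits_to_point I X)" using X by (simp add: f_def)
    qed
    then show ?thesis by (simp add: bit_influence_def cardE)
  qed
  also have "(\<Sum>X\<in>Pow E. f (bits_to_point I X)) = (\<Sum>b\<in>G. f b)"
    unfolding E_def G_def M_def
    by (rule sum.reindex_bij_betw[OF bij_betw_bits_to_point[OF assms(1)]])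
  also have "\<dots> = (\<Sum>b\<in>G. \<Sum>v<M. f (b(i := v))) / M"
    using sum_grid_resample[OF assms(1,2), where M = M and G = f] M0 by (simp add: G_def)
  also have "\<dots> \<le> (\<Sum>b\<in>G. 2 * (M * capped (2 ^ k / 2 ^ K) (fibre_count M A i b / 2 ^ K))) / M"
  proof (intro divide_right_mono sum_mono)
    fix b assume b: "b \<in> G"
    define r where "r = fibre_count M A i b"
    have mem: "b(i := v) \<in> A \<longleftrightarrow> v < r" if "v < M" for v
      unfolding r_def using assms b that by (intro fibre_count_down) (auto simp: G_def M_def)
    have "(\<Sum>v<M. f (b(i := v))) = (\<Sum>v<M. if (v < r) \<noteq> (flip_at k v < r) then 1 else 0)"
    proof (rule sum.cong[OF refl])
      fix v assume "v \<in> {..<M}"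
      then have "v < M" "flip_at k v < M" using flip_at_less[OF assms(3)] by (auto simp: M_def)
      then show "f (b(i := v)) = (if (v < r) \<noteq> (flip_at k v < r) then 1 else 0)"
        by (simp add: f_def mem)
    qed
    also have "\<dots> = card {v. v < 2 ^ K \<and> (v < r) \<noteq> (flip_at k v < r)}"
      using card_eq_sum_ind[of "{..<M}" "\<lambda>v. (v < r) \<noteq> (flip_at k v < r)"] by (simp add: M_def)
    also have "\<dots> \<le> 2 * min (2 ^ k) (min (real r) (2 ^ K - real r))"
      using fibre_count_le[of M A i b] by (intro threshold_bit_influence assms(3)) (simp add: r_def M_def)
    also have "min (2 ^ k) (min (real r) (2 ^ K - real r)) = M * capped (2 ^ k / 2 ^ K) (r / 2 ^ K)"
      by (simp add: M_def capped_def min_mult_distrib_left right_diff_distrib)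
    finally show "(\<Sum>v<M. f (b(i := v))) \<le> 2 * (M * capped (2 ^ k / 2 ^ K) (fibre_count M A i b / 2 ^ K))"
      by (simp only: r_def)
  qed simp
  also have "\<dots> = 2 * (\<Sum>b\<in>G. capped (2 ^ k / 2 ^ K) (fibre_count M A i b / 2 ^ K))"
    using M0 by (simp flip: sum_distrib_left)
  finally show ?thesis by (simp add: E_def G_def M_def divide_right_mono)
qed

lemma capped_sum_majorize:
  assumes "finite I" "i \<in> I" "A \<subseteq> grid I M" "A' \<subseteq> grid I M" "card A' = card A" "M > 0" "c \<le> 1/2"
    and maj: "\<And>c. (\<Sum>b\<in>grid I M. max 0 (real (fibre_count M A i b) - c))
       \<le> (\<Sum>b\<in>grid I M. max 0 (real (fibre_count M A' i b) - c))"
  shows "(\<Sum>b\<in>grid I M. capped c (fibre_count M A' i b / M)) \<le> (\<Sum>b\<in>grid I M. capped c (fibre_count M A i b / M))"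
proof -
  have hinge: "capped c (real n / M) = real n / M - max 0 (real n - M * c) / M - max 0 (real n - M * (1 - c)) / M" for n
    unfolding capped_as_hinges[OF assms(7)] using assms(6) by (auto simp: max_def field_simps)
  have eq: "(\<Sum>b\<in>grid I M. capped c (fibre_count M S i b / M))
      = (\<Sum>b\<in>grid I M. real (fibre_count M S i b)) / M
        - (\<Sum>b\<in>grid I M. max 0 (real (fibre_count M S i b) - M * c)) / M
        - (\<Sum>b\<in>grid I M. max 0 (real (fibre_count M S i b) - M * (1 - c))) / M" for S
    by (simp only: hinge sum_subtractf sum_divide_distrib)
  have "(\<Sum>b\<in>grid I M. real (fibre_count M A' i b)) = (\<Sum>b\<in>grid I M. real (fibre_count M A i b))"
    by (simp add: sum_fibre_count assms)
  then show ?thesis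
    unfolding eq using divide_right_mono[OF maj[of "M * c"], of "real M"]
      divide_right_mono[OF maj[of "M * (1 - c)"], of "real M"] by simp
qed

text \<open>
  For a random set, the mean of the left-hand side is thereby controlled by a first and a second
  moment; the bound is sharp when \<open>s\<close> equals \<open>sqrt x\<close>.
\<close>

lemma powr_three_halves_le:
  fixes x :: real
  assumes "x \<ge> 0" "s > 0"
  shows "x powr (3/2) \<le> (s * x + x\<^sup>2 / s) / 2"
proof -
  have "x powr (3/2) = x * sqrt x"
    using assms powr_add[of x 1 "1/2"] by (simp add: powr_half_sqrt)
  moreover have "sqrt x \<le> (s + x / s) / 2"
  proof -
    have "0 \<le> (s - sqrt x)\<^sup>2 / s" using assms by simp
    also have "\<dots> = s - 2 * sqrt x + x / s"
      using assms by (simp add: power2_diff add_divide_distrib diff_divide_distrib power2_eq_square[of s])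
    finally show ?thesis by simp
  qed
  then have "x * sqrt x \<le> x * ((s + x / s) / 2)" using assms by (intro mult_left_mono) auto
  ultimately show ?thesis by (simp add: power2_eq_square algebra_simps)
qed

text \<open>
  The inequality for the cube is applied to a down-set of the same size, whose bit influences are
  expressed through fibre sizes and hence, by majorization, through the fibre sizes of \<open>A\<close> itself.
  Here \<open>S i\<close> bounds the sum of the influences of all digits of coordinate \<open>i\<close>, and \<open>Q i\<close> bounds each
  one of them.
\<close>

theorem grid_kkl:
  assumes "finite I" "A \<subseteq> grid I (2 ^ K)" "s > 0"
  defines "N \<equiv> real (card (grid I (2 ^ K)))"
  defines "p \<equiv> \<lambda>i b. real (fibre_count (2 ^ K) A i b) / 2 ^ K"
  defines "S \<equiv> \<lambda>i. 2 / N * (\<Sum>b\<in>grid I (2 ^ K). \<Sum>k=1..K. capped ((1/2) ^ k) (p i b))"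
    and "Q \<equiv> \<lambda>i. 2 / N * (\<Sum>b\<in>grid I (2 ^ K). capped (1/2) (p i b))"
  shows "4 * (card A / N * (1 - card A / N))
     \<le> 3 ^ d * (\<Sum>i\<in>I. (s * S i + K * (Q i)\<^sup>2 / s) / 2) + (\<Sum>i\<in>I. S i) / (real d + 1)"
proof -
  define M :: nat where "M = 2 ^ K"
  define E where "E = I \<times> {..<K}"
  have M0: "M > 0" by (simp add: M_def)
  obtain A' where A': "A' \<subseteq> grid I M" "card A' = card A" "\<forall>i\<in>I. down_in A' i"
    and maj: "\<And>i c. i \<in> I \<Longrightarrow> (\<Sum>b\<in>grid I M. max 0 (real (fibre_count M A i b) - c))
       \<le> (\<Sum>b\<in>grid I M. max 0 (real (fibre_count M A' i b) - c))"
    using exists_down_set[OF assms(1) assms(2)[folded M_def] M0] by blast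
  define B where "B = {X \<in> Pow E. bits_to_point I X \<in> A'}"
  define J where "J e = bit_influence E B e" for e
  have finE: "finite E" using assms by (simp add: E_def)
  have bij: "bij_betw (bits_to_point I) (Pow E) (grid I M)"
    unfolding E_def M_def by (rule bij_betw_bits_to_point[OF assms(1)])
  have N: "2 ^ card E = N"
    using bij_betw_same_card[OF bij] finE by (simp add: N_def M_def card_Pow flip: of_nat_power)
  have "bits_to_point I ` B = A'"
  proof (intro equalityI subsetI)
    fix b assume "b \<in> A'"
    then obtain X where "X \<in> Pow E" "b = bits_to_point I X"
      using bij_betw_imp_surj_on[OF bij] A'(1) by blast
    then show "b \<in> bits_to_point I ` B" using \<open>b \<in> A'\<close> by (auto simp: B_def)
  qed (auto simp: B_def)
  moreover have "inj_on (bits_to_point I) B"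
    using bij unfolding bij_betw_def B_def by (auto intro: inj_on_subset)
  ultimately have cardB: "card B = card A"
    using A'(2) card_image by metis
  have N0: "N \<ge> 0" by (simp add: N_def)
  have J0: "J e \<ge> 0" for e by (simp add: J_def bit_influence_def)
  have bit: "J (i, k) \<le> 2 / N * (\<Sum>b\<in>grid I M. capped ((1/2) ^ (K - k)) (p i b))" if "i \<in> I" "k < K" for i k
  proof -
    have c: "2 ^ k / 2 ^ K = ((1/2) ^ (K - k) :: real)"
      using that by (simp add: power_diff power_divide)
    have c2: "(1/2) ^ (K - k) \<le> (1/2 :: real)"
      using that power_decreasing[of 1 "K - k" "1/2 :: real"] by simp
    have "J (i, k) \<le> 2 / N * (\<Sum>b\<in>grid I M. capped ((1/2) ^ (K - k)) (fibre_count M A' i b / M))"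
      using down_set_bit_influence[OF assms(1) that, of A'] A'
      by (simp add: J_def E_def B_def M_def N_def c that)
    also have "\<dots> \<le> 2 / N * (\<Sum>b\<in>grid I M. capped ((1/2) ^ (K - k)) (fibre_count M A i b / M))"
      using N0 A' assms(2) M0 maj[OF that(1)] that(1) assms(1) c2
      by (intro mult_left_mono capped_sum_majorize) (auto simp: M_def)
    finally show ?thesis by (simp add: p_def M_def)
  qed
  have reverse: "(\<Sum>k<K. g (K - k)) = (\<Sum>k=1..K. g k)" for g :: "nat \<Rightarrow> real"
    by (rule sum.reindex_bij_witness[where i = "\<lambda>k. K - k" and j = "\<lambda>k. K - k"]) auto
  have sumS: "(\<Sum>k<K. J (i, k)) \<le> S i" if "i \<in> I" for i
  proof -
    have "(\<Sum>k<K. J (i, k)) \<le> (\<Sum>k<K. 2 / N * (\<Sum>b\<in>grid I M. capped ((1/2) ^ (K - k)) (p i b)))"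
      using bit that by (intro sum_mono) auto
    also have "\<dots> = (\<Sum>k=1..K. 2 / N * (\<Sum>b\<in>grid I M. capped ((1/2) ^ k) (p i b)))"
      by (rule reverse)
    also have "\<dots> = S i"
      unfolding S_def M_def sum_distrib_left[symmetric] by (subst sum.swap) simp
    finally show ?thesis .
  qed
  have JQ: "J (i, k) \<le> Q i" if "i \<in> I" "k < K" for i k
  proof -
    have "(1/2) ^ (K - k) \<le> (1/2 :: real)"
      using that power_decreasing[of 1 "K - k" "1/2 :: real"] by simp
    then have "capped ((1/2) ^ (K - k)) t \<le> capped (1/2) t" for t
      unfolding capped_def by (intro min.mono order_refl)
    then show ?thesis using bit[OF that] N0 unfolding Q_def M_def
      by (elim order_trans) (intro mult_left_mono sum_mono; simp)
  qed
  have "(\<Sum>e\<in>E. J e powr (3/2)) \<le> (\<Sum>i\<in>I. (s * S i + K * (Q i)\<^sup>2 / s) / 2)"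
  proof -
    have "(\<Sum>e\<in>E. J e powr (3/2)) = (\<Sum>i\<in>I. \<Sum>k<K. J (i, k) powr (3/2))"
      unfolding E_def by (simp add: sum.cartesian_product)
    also have "\<dots> \<le> (\<Sum>i\<in>I. \<Sum>k<K. (s * J (i, k) + (Q i)\<^sup>2 / s) / 2)"
    proof (intro sum_mono)
      fix i k assume ik: "i \<in> I" "k \<in> {..<K}"
      have "(J (i, k))\<^sup>2 \<le> (Q i)\<^sup>2" using JQ[of i k] J0 ik by (intro power_mono) auto
      then show "J (i, k) powr (3/2) \<le> (s * J (i, k) + (Q i)\<^sup>2 / s) / 2"
        by (intro order_trans[OF powr_three_halves_le[OF J0 assms(3)]] divide_right_mono add_left_mono)
           (use \<open>(J (i, k))\<^sup>2 \<le> (Q i)\<^sup>2\<close> assms(3) in \<open>simp_all add: divide_right_mono\<close>)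
    qed
    also have "\<dots> = (\<Sum>i\<in>I. (s * (\<Sum>k<K. J (i, k)) + K * (Q i)\<^sup>2 / s) / 2)"
      by (simp add: sum.distrib sum_divide_distrib[symmetric] sum_distrib_left[symmetric])
    also have "\<dots> \<le> (\<Sum>i\<in>I. (s * S i + K * (Q i)\<^sup>2 / s) / 2)"
      using sumS assms(3) by (intro sum_mono divide_right_mono add_right_mono mult_left_mono) auto
    finally show ?thesis .
  qed
  moreover have "(\<Sum>e\<in>E. J e) \<le> (\<Sum>i\<in>I. S i)"
  proof -
    have "(\<Sum>e\<in>E. J e) = (\<Sum>i\<in>I. \<Sum>k<K. J (i, k))"
      unfolding E_def by (simp add: sum.cartesian_product)
    then show ?thesis using sumS by (simp add: sum_mono)
  qed
  moreover have "4 * (card B / 2 ^ card E * (1 - card B / 2 ^ card E)) \<le> 3 ^ d * (\<Sum>e\<in>E. J e powr (3/2)) + (\<Sum>e\<in>E. J e) / (real d + 1)"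
    unfolding J_def by (rule kkl_inequality[OF finE]) (auto simp: B_def)
  ultimately show ?thesis
    unfolding cardB N
    by (elim order_trans) (intro add_mono mult_left_mono divide_right_mono; simp)
qed

lemma capped_le_pair_disagreement:
  assumes "0 \<le> t" "t \<le> 1"
  shows "capped (1/2) t \<le> 2 * (t * (1 - t))" "t * (1 - t) \<le> capped (1/2) t"
proof -
  have "min t (1 - t) \<le> 2 * (t * (1 - t))"
  proof (cases "t \<le> 1/2")
    case True
    then have "t * 1 \<le> t * (2 * (1 - t))" using assms by (intro mult_left_mono) auto
    then show ?thesis by (simp add: algebra_simps)
  next
    case False
    then have "(1 - t) * 1 \<le> (1 - t) * (2 * t)" using assms by (intro mult_left_mono) auto
    then show ?thesis by (simp add: algebra_simps)
  qed
  then show "capped (1/2) t \<le> 2 * (t * (1 - t))" by (simp add: capped_def)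
  have "t * (1 - t) \<le> t * 1" "t * (1 - t) \<le> 1 * (1 - t)"
    using assms mult_left_le[of "1 - t" t] mult_right_le_one_le[of "1 - t" t] by (auto simp: mult.commute)
  moreover have "t * (1 - t) \<le> 1/2"
    using sum_squares_ge_zero[of "t - 1/2" 0] by (simp add: algebra_simps)
  ultimately show "t * (1 - t) \<le> capped (1/2) t" by (simp add: capped_def)
qed

text \<open>
  The left-hand side is quadratic in the indicator of \<open>A\<close>, so that for a random set its moments
  can be computed; the concave functions of the fibre sizes are compared with it.
\<close>

lemma sum_resample_disagreement:
  assumes "finite I" "i \<in> I" "M > 0"
  shows "(\<Sum>b\<in>grid I M. \<Sum>k<M. if (b \<in> A) \<noteq> (b(i := k) \<in> A) then 1 else 0 :: real)
     = M * (\<Sum>b\<in>grid I M. 2 * (fibre_count M A i b / M * (1 - fibre_count M A i b / M)))"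
proof -
  define g where "g b = (\<Sum>k<M. if (b \<in> A) \<noteq> (b(i := k) \<in> A) then 1 else 0 :: real)" for b
  define x where "x b v = (if b(i := v) \<in> A then 1 else 0 :: real)" for b v
  have cnt: "(\<Sum>v<M. x b v) = fibre_count M A i b" for b
    by (simp add: x_def fibre_count_sum)
  have "(\<Sum>v<M. g (b(i := v))) = M * (M * (2 * (fibre_count M A i b / M * (1 - fibre_count M A i b / M))))" for b
  proof -
    have "(\<Sum>v<M. g (b(i := v))) = (\<Sum>v<M. \<Sum>k<M. x b v + x b k - 2 * (x b v * x b k))"
      unfolding g_def by (intro sum.cong refl) (auto simp: x_def)
    also have "\<dots> = 2 * (M * real (fibre_count M A i b)) - 2 * (real (fibre_count M A i b))\<^sup>2"
      by (simp add: sum.distrib sum_subtractf sum_distrib_left[symmetric] sum_distrib_right[symmetric] cnt power2_eq_square)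
    also have "\<dots> = M * (M * (2 * (fibre_count M A i b / M * (1 - fibre_count M A i b / M))))"
    proof -
      have "2 * (m * c) - 2 * c\<^sup>2 = m * (m * (2 * (c / m * (1 - c / m))))" if "m > 0" for m c :: real
        using that by (simp add: field_simps power2_eq_square)
      then show ?thesis using assms(3) by simp
    qed
    finally show ?thesis .
  qed
  then have "M * (\<Sum>b\<in>grid I M. g b)
      = M * (M * (\<Sum>b\<in>grid I M. 2 * (fibre_count M A i b / M * (1 - fibre_count M A i b / M))))"
    using sum_grid_resample[OF assms(1,2), where M = M and G = g] by (simp add: sum_distrib_left)
  then show ?thesis using assms(3) by (simp add: g_def)
qed

section \<open>Moments of a random sample\<close>

abbreviation iid :: "'l set \<Rightarrow> 'a measure \<Rightarrow> ('l \<Rightarrow> 'a) measure" where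
  "iid L \<mu> \<equiv> PiM L (\<lambda>_. \<mu>)"

lemma measurable_reindex:
  "\<sigma> \<in> I \<rightarrow> L \<Longrightarrow> (\<lambda>y. \<lambda>i\<in>I. y (\<sigma> i)) \<in> measurable (iid L \<mu>) (iid I \<mu>)"
  by (intro measurable_restrict measurable_component_singleton) auto

lemma integral_reindex:
  fixes g :: "_ \<Rightarrow> real"
  assumes "prob_space \<mu>" "inj_on \<sigma> I" "\<sigma> \<in> I \<rightarrow> L" "g \<in> borel_measurable (iid I \<mu>)"
  shows "(\<integral>y. g (\<lambda>i\<in>I. y (\<sigma> i)) \<partial>iid L \<mu>) = (\<integral>x. g x \<partial>iid I \<mu>)"
  using integral_distr[OF measurable_reindex[OF assms(3), where \<mu> = \<mu>] assms(4)]
    distr_PiM_reindex[OF assms(1) assms(2,3)] by simp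

lemma integral_reindex_disjoint:
  fixes f g :: "('i \<Rightarrow> 'a) \<Rightarrow> real" and \<sigma> \<tau> :: "'i \<Rightarrow> 'l"
  assumes "prob_space \<mu>" "\<sigma> \<in> I \<rightarrow> L" "\<tau> \<in> I \<rightarrow> L" "\<sigma> ` I \<inter> \<tau> ` I = {}" "I \<noteq> {}"
    and "f \<in> borel_measurable (iid I \<mu>)" "\<And>x. \<bar>f x\<bar> \<le> B"
    and "g \<in> borel_measurable (iid I \<mu>)" "\<And>x. \<bar>g x\<bar> \<le> B"
  shows "(\<integral>y. f (\<lambda>i\<in>I. y (\<sigma> i)) * g (\<lambda>i\<in>I. y (\<tau> i)) \<partial>iid L \<mu>)
    = (\<integral>y. f (\<lambda>i\<in>I. y (\<sigma> i)) \<partial>iid L \<mu>) * (\<integral>y. g (\<lambda>i\<in>I. y (\<tau> i)) \<partial>iid L \<mu>)"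
proof -
  interpret P: prob_space "iid L \<mu>" by (intro prob_space_PiM assms)
  have "L \<noteq> {}" using assms by auto
  have "P.indep_vars (\<lambda>_. \<mu>) (\<lambda>l y. y l) L"
  proof (subst P.indep_vars_iff_distr_eq_PiM'[OF \<open>L \<noteq> {}\<close>])
    have "distr (iid L \<mu>) (iid L \<mu>) (\<lambda>x. \<lambda>i\<in>L. x i) = distr (iid L \<mu>) (iid L \<mu>) (\<lambda>x. x)"
      by (intro distr_cong refl) (auto simp: space_PiM PiE_def extensional_def restrict_def fun_eq_iff)
    moreover have "iid L \<mu> = PiM L (\<lambda>i. distr (iid L \<mu>) \<mu> (\<lambda>y. y i))"
      using assms(1) by (intro PiM_cong refl distr_PiM_component[symmetric]) auto
    ultimately show "distr (iid L \<mu>) (iid L \<mu>) (\<lambda>x. \<lambda>i\<in>L. x i) = PiM L (\<lambda>i. distr (iid L \<mu>) \<mu> (\<lambda>y. y i))"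
      by (simp add: distr_id)
  qed auto
  then have ind: "P.indep_var (iid (\<sigma> ` I) \<mu>) (\<lambda>y. \<lambda>l\<in>\<sigma> ` I. y l) (iid (\<tau> ` I) \<mu>) (\<lambda>y. \<lambda>l\<in>\<tau> ` I. y l)"
    using assms(2-4) by (intro P.indep_var_restrict) auto
  have f': "(\<lambda>y. f (\<lambda>i\<in>I. y (\<sigma> i))) \<in> borel_measurable (iid (\<sigma> ` I) \<mu>)"
    and g': "(\<lambda>y. g (\<lambda>i\<in>I. y (\<tau> i))) \<in> borel_measurable (iid (\<tau> ` I) \<mu>)"
    by (rule measurable_compose[OF measurable_reindex]; use assms in auto)+
  have fL: "(\<lambda>y. f (\<lambda>i\<in>I. y (\<sigma> i))) \<in> borel_measurable (iid L \<mu>)"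
    and gL: "(\<lambda>y. g (\<lambda>i\<in>I. y (\<tau> i))) \<in> borel_measurable (iid L \<mu>)"
    by (rule measurable_compose[OF measurable_reindex]; use assms in auto)+
  have r: "(\<lambda>i\<in>I. (\<lambda>l\<in>\<sigma> ` I. y l) (\<sigma> i)) = (\<lambda>i\<in>I. y (\<sigma> i))" for \<sigma> :: "'i \<Rightarrow> 'l" and y :: "'l \<Rightarrow> 'a"
    by (auto simp: fun_eq_iff)
  have "P.indep_var borel (\<lambda>y. f (\<lambda>i\<in>I. y (\<sigma> i))) borel (\<lambda>y. g (\<lambda>i\<in>I. y (\<tau> i)))"
    using P.indep_var_compose[OF ind f' g'] unfolding comp_def r .
  then show ?thesis
    using fL gL assms(7,9)
    by (intro P.indep_var_lebesgue_integral P.integrable_const_bound[where B = B]) auto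
qed

text \<open>
  Each summand is the indicator of an event of probability \<open>e\<close>, because an injective choice of sample
  points is again an independent family. Two choices with disjoint ranges are independent and
  contribute \<open>e\<^sup>2\<close> to the second moment; the overlapping pairs collected in \<open>O'\<close> contribute at
  most \<open>e\<close>.
\<close>

lemma sampling_moments:
  fixes \<sigma> :: "'t \<Rightarrow> 'i \<Rightarrow> 'l" and e :: real
  assumes "prob_space \<mu>" "finite T" "I \<noteq> {}" "\<And>t. t \<in> T \<Longrightarrow> inj_on (\<sigma> t) I" "\<And>t. t \<in> T \<Longrightarrow> \<sigma> t \<in> I \<rightarrow> L"
    and A: "A \<in> sets (iid I \<mu>)"
  defines "X \<equiv> \<lambda>y. \<Sum>t\<in>T. indicator A (\<lambda>i\<in>I. y (\<sigma> t i)) :: real"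
    and "e \<equiv> measure (iid I \<mu>) A"
    and "O' \<equiv> {(t, u) \<in> T \<times> T. \<sigma> t ` I \<inter> \<sigma> u ` I \<noteq> {}}"
  shows "X \<in> borel_measurable (iid L \<mu>)"
    and "(\<integral>y. X y \<partial>iid L \<mu>) = card T * e"
    and "(\<integral>y. (X y)\<^sup>2 \<partial>iid L \<mu>) \<le> (card T * e)\<^sup>2 + card O' * (e - e\<^sup>2)"
proof -
  interpret P: prob_space "iid L \<mu>" by (intro prob_space_PiM assms)
  interpret Q: prob_space "iid I \<mu>" by (intro prob_space_PiM assms)
  define x where "x t y = (indicator A (\<lambda>i\<in>I. y (\<sigma> t i)) :: real)" for t y
  have ind: "indicator A \<in> borel_measurable (iid I \<mu>)" using A by simp
  have xm: "x t \<in> borel_measurable (iid L \<mu>)" if "t \<in> T" for t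
    unfolding x_def by (rule measurable_compose[OF measurable_reindex ind]) (use assms that in auto)
  then show "X \<in> borel_measurable (iid L \<mu>)" unfolding X_def x_def by simp
  have x01: "0 \<le> x t y" "x t y \<le> 1" for t y by (auto simp: x_def)
  have xint: "integrable (iid L \<mu>) (x t)" if "t \<in> T" for t
    using xm[OF that] by (intro P.integrable_const_bound[where B = 1]) (auto simp: x_def)
  have xxint: "integrable (iid L \<mu>) (\<lambda>y. x t y * x u y)" if "t \<in> T" "u \<in> T" for t u
    using x01 xm that
    by (intro P.integrable_const_bound[where B = 1] borel_measurable_times) (auto simp: mult_le_one)
  have ex: "(\<integral>y. x t y \<partial>iid L \<mu>) = e" if "t \<in> T" for t
    unfolding x_def using integral_reindex[OF assms(1) assms(4,5)[OF that] ind] A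
    by (simp add: e_def Int_absorb2 sets.sets_into_space)
  show "(\<integral>y. X y \<partial>iid L \<mu>) = card T * e"
    unfolding X_def x_def[symmetric] using xint ex by (subst Bochner_Integration.integral_sum) auto
  have "(\<integral>y. (X y)\<^sup>2 \<partial>iid L \<mu>) = (\<Sum>t\<in>T. \<Sum>u\<in>T. \<integral>y. x t y * x u y \<partial>iid L \<mu>)"
    unfolding X_def x_def[symmetric] power2_eq_square sum_product
    using xxint by (simp add: Bochner_Integration.integral_sum)
  also have "\<dots> \<le> (\<Sum>t\<in>T. \<Sum>u\<in>T. e\<^sup>2 + (if (t, u) \<in> O' then e - e\<^sup>2 else 0))"
  proof (intro sum_mono)
    fix t u assume tu: "t \<in> T" "u \<in> T"
    show "(\<integral>y. x t y * x u y \<partial>iid L \<mu>) \<le> e\<^sup>2 + (if (t, u) \<in> O' then e - e\<^sup>2 else 0)"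
    proof (cases "(t, u) \<in> O'")
      case True
      have "(\<integral>y. x t y * x u y \<partial>iid L \<mu>) \<le> (\<integral>y. x t y \<partial>iid L \<mu>)"
        by (rule integral_mono[OF xxint[OF tu] xint[OF tu(1)]]) (simp add: x01 mult_left_le)
      then show ?thesis using True ex[OF tu(1)] by simp
    next
      case False
      then have "\<sigma> t ` I \<inter> \<sigma> u ` I = {}" using tu by (auto simp: O'_def)
      then have "(\<integral>y. x t y * x u y \<partial>iid L \<mu>) = (\<integral>y. x t y \<partial>iid L \<mu>) * (\<integral>y. x u y \<partial>iid L \<mu>)"
        unfolding x_def using assms(1,3,5) tu ind
        by (intro integral_reindex_disjoint[where B = 1]) auto
      then show ?thesis using False ex tu by (simp add: power2_eq_square)
    qed
  qed
  also have "\<dots> = (\<Sum>p\<in>T \<times> T. e\<^sup>2 + (if p \<in> O' then e - e\<^sup>2 else 0))"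
    by (simp add: sum.cartesian_product)
  also have "\<dots> = (card T * e)\<^sup>2 + card O' * (e - e\<^sup>2)"
  proof -
    have "O' \<subseteq> T \<times> T" by (auto simp: O'_def)
    then show ?thesis using assms(2)
      by (simp add: sum.distrib sum.If_cases Int_absorb1 card_cartesian_product power2_eq_square)
  qed
  finally show "(\<integral>y. (X y)\<^sup>2 \<partial>iid L \<mu>) \<le> (card T * e)\<^sup>2 + card O' * (e - e\<^sup>2)" .
qed

section \<open>Random subsets of the grid\<close>

definition sampled_set :: "'i set \<Rightarrow> nat \<Rightarrow> ('i \<Rightarrow> 'a) set \<Rightarrow> ('i \<times> nat \<Rightarrow> 'a) \<Rightarrow> ('i \<Rightarrow> nat) set" where
  "sampled_set I M A y = {b \<in> grid I M. (\<lambda>i\<in>I. y (i, b i)) \<in> A}"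

lemma sum_grid_coordinate:
  assumes "finite I" "i \<in> I" "v < M"
  shows "(\<Sum>b\<in>grid I M. if b i = v then 1 else 0) = real (card (grid I M)) / M"
proof -
  have "real M * (\<Sum>b\<in>grid I M. if b i = v then 1 else 0) = (\<Sum>b\<in>grid I M. \<Sum>k<M. if (b(i := k)) i = v then 1 else 0)"
    by (rule sum_grid_resample[OF assms(1,2), symmetric])
  also have "\<dots> = card (grid I M)" using assms(3) by simp
  finally show ?thesis using assms(3) by (simp add: field_simps)
qed

text \<open>
  Two points of the grid without a common coordinate use disjoint parts of the sample, and a proportion
  of at most \<open>card I / M\<close> of all pairs have a common coordinate.
\<close>

lemma sampled_variance:
  fixes I :: "'i set" and \<mu> :: "'a measure"
  assumes "prob_space \<mu>" "finite I" "I \<noteq> {}" "A \<in> sets (iid I \<mu>)" "M > 0"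
  defines "a \<equiv> measure (iid I \<mu>) A" and "N \<equiv> real (card (grid I M))"
    and "L \<equiv> I \<times> {..<M}"
    and "m \<equiv> \<lambda>y. real (card (sampled_set I M A y)) / real (card (grid I M))"
  shows "m \<in> borel_measurable (iid L \<mu>)"
    and "(1 - card I / M) * (a * (1 - a)) \<le> (\<integral>y. m y * (1 - m y) \<partial>iid L \<mu>)"
proof -
  interpret P: prob_space "iid L \<mu>" by (intro prob_space_PiM assms)
  interpret Q: prob_space "iid I \<mu>" by (intro prob_space_PiM assms)
  define \<sigma> where "\<sigma> b i = (i, b i)" for b :: "'i \<Rightarrow> nat" and i
  define X where "X y = (\<Sum>b\<in>grid I M. indicator A (\<lambda>i\<in>I. y (\<sigma> b i)) :: real)" for y
  define O' where "O' = {(b, b') \<in> grid I M \<times> grid I M. \<sigma> b ` I \<inter> \<sigma> b' ` I \<noteq> {}}"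
  have fin: "finite (grid I M)" by (rule finite_grid[OF assms(2)])
  have N0: "N > 0" using assms(2,5) by (simp add: N_def card_grid)
  have inj: "inj_on (\<sigma> b) I" for b by (auto simp: inj_on_def \<sigma>_def)
  have to: "\<sigma> b \<in> I \<rightarrow> L" if "b \<in> grid I M" for b using that by (auto simp: \<sigma>_def L_def dest: grid_less)
  note moments = sampling_moments[where \<sigma> = \<sigma>, OF assms(1) fin assms(3) inj to assms(4), folded X_def O'_def a_def N_def]
  have m: "m y = X y / N" for y
    using card_eq_sum_ind[OF fin, of "\<lambda>b. (\<lambda>i\<in>I. y (i, b i)) \<in> A"]
    by (simp add: m_def X_def N_def sampled_set_def \<sigma>_def indicator_def of_bool_def)
  have Xm: "X \<in> borel_measurable (iid L \<mu>)" by (rule moments(1))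
  then show mm: "m \<in> borel_measurable (iid L \<mu>)" unfolding m by simp
  have m01: "0 \<le> m y" "m y \<le> 1" for y
    using N0 card_mono[OF fin, of "sampled_set I M A y"] by (auto simp: m_def N_def sampled_set_def)
  have int1: "integrable (iid L \<mu>) m"
    using m01 mm by (intro P.integrable_const_bound[where B = 1]) auto
  have int2: "integrable (iid L \<mu>) (\<lambda>y. (m y)\<^sup>2)"
    using m01 mm by (intro P.integrable_const_bound[where B = 1]) (auto simp: power_le_one)
  have e1: "(\<integral>y. m y \<partial>iid L \<mu>) = a"
    unfolding m using moments(2) N0 by simp
  have cardO: "card O' \<le> N\<^sup>2 * (card I / M)"
  proof -
    have "real (card O') = (\<Sum>(b, b')\<in>grid I M \<times> grid I M. if \<sigma> b ` I \<inter> \<sigma> b' ` I \<noteq> {} then 1 else 0)"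
      using card_eq_sum_ind[of "grid I M \<times> grid I M" "\<lambda>(b, b'). \<sigma> b ` I \<inter> \<sigma> b' ` I \<noteq> {}"] fin
      by (simp add: O'_def case_prod_unfold mem_Times_iff)
    also have "\<dots> = (\<Sum>b\<in>grid I M. \<Sum>b'\<in>grid I M. if \<sigma> b ` I \<inter> \<sigma> b' ` I \<noteq> {} then 1 else 0)"
      by (simp add: sum.cartesian_product)
    also have "\<dots> \<le> (\<Sum>b\<in>grid I M. \<Sum>b'\<in>grid I M. \<Sum>i\<in>I. if b' i = b i then 1 else 0)"
    proof (intro sum_mono)
      fix b b' :: "'i \<Rightarrow> nat"
      show "(if \<sigma> b ` I \<inter> \<sigma> b' ` I \<noteq> {} then 1 else 0) \<le> (\<Sum>i\<in>I. if b' i = b i then 1 else 0 :: real)"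
      proof (cases "\<exists>i\<in>I. b' i = b i")
        case True
        then obtain i where i: "i \<in> I" "b' i = b i" by blast
        then have "(if b' i = b i then 1 else 0 :: real) \<le> (\<Sum>i\<in>I. if b' i = b i then 1 else 0)"
          using assms(2) by (intro member_le_sum) auto
        then show ?thesis using i by auto
      next
        case False
        then have "\<sigma> b ` I \<inter> \<sigma> b' ` I = {}" by (auto simp: \<sigma>_def)
        then show ?thesis by (simp add: sum_nonneg)
      qed
    qed
    also have "\<dots> = (\<Sum>b\<in>grid I M. \<Sum>i\<in>I. \<Sum>b'\<in>grid I M. if b' i = b i then 1 else 0)"
      by (intro sum.cong refl sum.swap)
    also have "\<dots> = (\<Sum>b\<in>grid I M. \<Sum>i\<in>I. N / M)"
      unfolding N_def using assms(2) by (intro sum.cong refl sum_grid_coordinate) (auto dest: grid_less)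
    also have "\<dots> = N\<^sup>2 * (card I / M)" by (simp add: N_def power2_eq_square)
    finally show ?thesis .
  qed
  have a2: "a - a\<^sup>2 \<ge> 0" using Q.prob_le_1[of A] measure_nonneg[of "iid I \<mu>" A]
    by (simp add: a_def power2_eq_square mult_left_le)
  have "(\<integral>y. (X y)\<^sup>2 \<partial>iid L \<mu>) \<le> (N * a)\<^sup>2 + N\<^sup>2 * (card I / M) * (a - a\<^sup>2)"
    using moments(3) mult_right_mono[OF cardO a2] by linarith
  then have "(\<integral>y. (X y)\<^sup>2 \<partial>iid L \<mu>) / N\<^sup>2 \<le> ((N * a)\<^sup>2 + N\<^sup>2 * (card I / M) * (a - a\<^sup>2)) / N\<^sup>2"
    by (intro divide_right_mono) auto
  moreover have "(\<integral>y. (m y)\<^sup>2 \<partial>iid L \<mu>) = (\<integral>y. (X y)\<^sup>2 \<partial>iid L \<mu>) / N\<^sup>2"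
    unfolding m power_divide by simp
  moreover have "((N * a)\<^sup>2 + N\<^sup>2 * (card I / M) * (a - a\<^sup>2)) / N\<^sup>2 = a\<^sup>2 + card I / M * (a - a\<^sup>2)"
    using N0 by (simp add: field_simps)
  moreover have "(\<integral>y. m y * (1 - m y) \<partial>iid L \<mu>) = a - (\<integral>y. (m y)\<^sup>2 \<partial>iid L \<mu>)"
    using int1 int2 e1 by (simp add: right_diff_distrib power2_eq_square)
  ultimately show "(1 - card I / M) * (a * (1 - a)) \<le> (\<integral>y. m y * (1 - m y) \<partial>iid L \<mu>)"
    by (simp add: algebra_simps power2_eq_square)
qed

lemma sampled_set_iff:
  "b \<in> sampled_set I M A y \<longleftrightarrow> b \<in> grid I M \<and> (\<lambda>i\<in>I. y (i, b i)) \<in> A"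
  by (simp add: sampled_set_def)

text \<open>
  \<open>R\<close> is the probability that a random point of the grid and the point with coordinate \<open>i\<close> resampled
  disagree about membership. Such a pair uses one sample point per coordinate and a second one for
  coordinate \<open>i\<close>, which gets the label \<open>None\<close>. Two independent pairs share a sample point with
  probability at most \<open>(card I + 3) / M\<close>, so \<open>R\<close> is concentrated.
\<close>

lemma sampled_disagreement:
  fixes I :: "'i set" and \<mu> :: "'a measure"
  assumes "prob_space \<mu>" "space \<mu> = UNIV" "finite I" "i \<in> I" "A \<in> sets (iid I \<mu>)" "M \<ge> 2"
  defines "L \<equiv> I \<times> {..<M}" and "N \<equiv> real (card (grid I M))"
    and "R \<equiv> \<lambda>y. (\<Sum>b\<in>grid I M. \<Sum>k<M. if (b \<in> sampled_set I M A y) \<noteq> (b(i := k) \<in> sampled_set I M A y)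
                    then 1 else 0) / (real (card (grid I M)) * real M)"
  shows "R \<in> borel_measurable (iid L \<mu>)"
    and "(\<integral>y. (R y)\<^sup>2 \<partial>iid L \<mu>) \<le> (\<integral>y. R y \<partial>iid L \<mu>)\<^sup>2 + 2 * (card I + 3) / M * (\<integral>y. R y \<partial>iid L \<mu>)"
proof -
  define G where "G = grid I M"
  define I' where "I' = insert None (Some ` I)"
  \<comment> \<open>Resampling to the same value contributes nothing; leaving it out makes the choice
    of sample points injective.\<close>
  define T where "T = (SIGMA b:G. {..<M} - {b i})"
  define \<sigma> where "\<sigma> t j = (case j of None \<Rightarrow> (i, snd t) | Some j \<Rightarrow> (j, fst t j))"
    for t :: "('i \<Rightarrow> nat) \<times> nat" and j
  define here where "here = (\<lambda>w::'i option \<Rightarrow> 'a. \<lambda>j\<in>I. w (Some j))"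
  define there where "there = (\<lambda>w::'i option \<Rightarrow> 'a. \<lambda>j\<in>I. w (if j = i then None else Some j))"
  define H where "H = here -` A \<inter> space (iid I' \<mu>)"
  define H' where "H' = there -` A \<inter> space (iid I' \<mu>)"
  define B where "B = (H - H') \<union> (H' - H)"
  define X where "X y = (\<Sum>t\<in>T. indicator B (\<lambda>j\<in>I'. y (\<sigma> t j)) :: real)" for y
  define e where "e = measure (iid I' \<mu>) B"
  define O' where "O' = {(t, u) \<in> T \<times> T. \<sigma> t ` I' \<inter> \<sigma> u ` I' \<noteq> {}}"
  have finG: "finite G" unfolding G_def by (rule finite_grid[OF assms(3)])
  have finT: "finite T" unfolding T_def using finG by auto
  have N0: "N > 0" using assms(3,6) by (simp add: N_def card_grid)
  have M2: "real M \<ge> 2" using assms(6) by simp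
  have Gi: "b j < M" if "b \<in> G" "j \<in> I" for b j using that by (simp add: G_def grid_less)
  have "here \<in> measurable (iid I' \<mu>) (iid I \<mu>)" "there \<in> measurable (iid I' \<mu>) (iid I \<mu>)"
    unfolding here_def there_def by (rule measurable_reindex; auto simp: I'_def)+
  then have Bm: "B \<in> sets (iid I' \<mu>)"
    unfolding B_def H_def H'_def using assms(5) by (intro sets.Un sets.Diff measurable_sets) auto
  have inj: "inj_on (\<sigma> t) I'" if "t \<in> T" for t
    using that assms(4) by (auto simp: inj_on_def \<sigma>_def I'_def T_def)
  have to: "\<sigma> t \<in> I' \<rightarrow> L" if "t \<in> T" for t
    using that assms(4) by (auto simp: \<sigma>_def I'_def T_def L_def Gi)
  interpret P: prob_space "iid L \<mu>" by (intro prob_space_PiM assms)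
  interpret Q: prob_space "iid I' \<mu>" by (intro prob_space_PiM assms)
  have ne: "I' \<noteq> {}" by (simp add: I'_def)
  note moments = sampling_moments[where \<sigma> = \<sigma>, OF assms(1) finT ne inj to Bm, folded X_def O'_def e_def]
  have X_eq: "X y = N * M * R y" for y
  proof -
    have ind: "indicator B (\<lambda>j\<in>I'. y (\<sigma> (b, k) j))
        = (if (b \<in> sampled_set I M A y) \<noteq> (b(i := k) \<in> sampled_set I M A y) then 1 else 0 :: real)"
      if "b \<in> G" "k < M" for b k
    proof -
      define w where "w = (\<lambda>j\<in>I'. y (\<sigma> (b, k) j))"
      have "w \<in> space (iid I' \<mu>)" by (simp add: space_PiM assms(2) w_def)
      moreover have "here w = (\<lambda>j\<in>I. y (j, b j))"
        by (auto simp: here_def w_def I'_def \<sigma>_def fun_eq_iff)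
      moreover have "there w = (\<lambda>j\<in>I. y (j, (b(i := k)) j))"
        by (auto simp: there_def w_def I'_def \<sigma>_def fun_eq_iff)
      moreover have "b(i := k) \<in> G" using that assms(4) by (simp add: G_def grid_upd)
      ultimately have "w \<in> B \<longleftrightarrow> (b \<in> sampled_set I M A y) \<noteq> (b(i := k) \<in> sampled_set I M A y)"
        using that(1) unfolding B_def H_def H'_def sampled_set_iff G_def by auto
      then show ?thesis by (simp add: w_def indicator_def)
    qed
    have "X y = (\<Sum>b\<in>G. \<Sum>k\<in>{..<M} - {b i}. indicator B (\<lambda>j\<in>I'. y (\<sigma> (b, k) j)))"
      unfolding X_def T_def using finG by (subst sum.Sigma) auto
    also have "\<dots> = (\<Sum>b\<in>G. \<Sum>k<M. if (b \<in> sampled_set I M A y) \<noteq> (b(i := k) \<in> sampled_set I M A y) then 1 else 0)"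
    proof (rule sum.cong[OF refl])
      fix b assume b: "b \<in> G"
      show "(\<Sum>k\<in>{..<M} - {b i}. indicator B (\<lambda>j\<in>I'. y (\<sigma> (b, k) j)))
        = (\<Sum>k<M. if (b \<in> sampled_set I M A y) \<noteq> (b(i := k) \<in> sampled_set I M A y) then 1 else 0 :: real)"
        using b by (intro sum.mono_neutral_cong_left) (auto simp: ind)
    qed
    finally show ?thesis using N0 M2 by (simp add: R_def N_def G_def)
  qed
  have R_eq: "R y = X y / (N * M)" for y
    using N0 M2 by (simp add: X_eq)
  have Xm: "X \<in> borel_measurable (iid L \<mu>)" by (rule moments(1))
  then show "R \<in> borel_measurable (iid L \<mu>)" unfolding R_eq by simp
  define r where "r = (\<integral>y. R y \<partial>iid L \<mu>)"
  have "(\<integral>y. X y \<partial>iid L \<mu>) = N * M * r" unfolding X_eq r_def by simp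
  then have Te: "card T * e = N * M * r" using moments(2) by simp
  have cardT: "real (card T) = N * (M - 1)"
  proof -
    have "card ({..<M} - {b i}) = M - 1" if "b \<in> G" for b
      using Gi[OF that assms(4)] by simp
    then show ?thesis using finG assms(6) by (simp add: T_def N_def G_def)
  qed
  have e0: "e \<ge> 0" by (simp add: e_def)
  have e2r: "e \<le> 2 * r"
  proof -
    have "N * ((M - 1) * e) = N * (M * r)" using Te cardT assms(6) by (simp add: of_nat_diff)
    then have "(M - 1) * e = M * r" using N0 by simp
    moreover have "M * e \<le> 2 * ((real M - 1) * e)"
      using mult_right_mono[OF M2 e0] by (simp add: algebra_simps)
    ultimately have "M * e \<le> M * (2 * r)" using assms(6) by (simp add: of_nat_diff)
    then show ?thesis using M2 by simp
  qed
  have cardO: "card O' \<le> N\<^sup>2 * M * (card I + 3)"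
  proof -
    define hit where "hit b b' k k' = (\<Sum>j\<in>I. if b' j = b j then 1 else 0) + (if b' i = k then 1 else 0)
      + (if k' = b i then 1 else 0) + (if k' = k then 1 else 0 :: real)" for b b' :: "'i \<Rightarrow> nat" and k k' :: nat
    have hit0: "hit b b' k k' \<ge> 0" for b b' k k' by (simp add: hit_def sum_nonneg)
    have sub: "O' \<subseteq> (G \<times> {..<M}) \<times> (G \<times> {..<M})" by (auto simp: O'_def T_def)
    have "real (card O') = (\<Sum>p\<in>O'. 1)" by simp
    also have "\<dots> \<le> (\<Sum>p\<in>O'. hit (fst (fst p)) (fst (snd p)) (snd (fst p)) (snd (snd p)))"
    proof (rule sum_mono)
      fix p assume p: "p \<in> O'"
      obtain b k b' k' where pe: "p = ((b, k), (b', k'))" by (metis surj_pair)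
      have "(\<exists>j\<in>I. b' j = b j) \<or> b' i = k \<or> k' = b i \<or> k' = k"
        using p unfolding O'_def pe by (auto simp: \<sigma>_def I'_def)
      moreover have "1 \<le> (\<Sum>j\<in>I. if b' j = b j then 1 else 0 :: real)" if "j \<in> I" "b' j = b j" for j
        using member_le_sum[of j I "\<lambda>j. if b' j = b j then 1 else 0 :: real"] that assms(3) by simp
      moreover have "0 \<le> (\<Sum>j\<in>I. if b' j = b j then 1 else 0 :: real)" by (simp add: sum_nonneg)
      ultimately show "1 \<le> hit (fst (fst p)) (fst (snd p)) (snd (fst p)) (snd (snd p))"
        unfolding pe hit_def by (auto intro: add_increasing2 add_increasing)
    qed
    also have "\<dots> \<le> (\<Sum>p\<in>(G \<times> {..<M}) \<times> (G \<times> {..<M}). hit (fst (fst p)) (fst (snd p)) (snd (fst p)) (snd (snd p)))"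
      using sub finG hit0 by (intro sum_mono2) auto
    also have "\<dots> = (\<Sum>b\<in>G. \<Sum>k<M. \<Sum>b'\<in>G. \<Sum>k'<M. hit b b' k k')"
      by (simp add: sum.cartesian_product')
    also have "\<dots> = (\<Sum>b\<in>G. \<Sum>k<M. N * (card I + 3))"
    proof (intro sum.cong refl)
      fix b k assume b: "b \<in> G" and k: "k \<in> {..<M}"
      have "(\<Sum>b'\<in>G. \<Sum>k'<M. hit b b' k k')
          = (\<Sum>b'\<in>G. real M * (\<Sum>j\<in>I. if b' j = b j then 1 else 0) + real M * (if b' i = k then 1 else 0) + 2)"
        using k Gi[OF b assms(4)] by (intro sum.cong refl) (simp add: hit_def sum.distrib distrib_left)
      also have "\<dots> = real M * (\<Sum>b'\<in>G. \<Sum>j\<in>I. if b' j = b j then 1 else 0)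
          + real M * (\<Sum>b'\<in>G. if b' i = k then 1 else 0) + 2 * N"
        by (simp add: sum.distrib sum_distrib_left[symmetric] N_def G_def)
      also have "(\<Sum>b'\<in>G. \<Sum>j\<in>I. if b' j = b j then 1 else 0 :: real) = (\<Sum>j\<in>I. \<Sum>b'\<in>G. if b' j = b j then 1 else 0)"
        by (rule sum.swap)
      also have "\<dots> = (\<Sum>j\<in>I. N / M)"
        unfolding N_def G_def using assms(3) b Gi by (intro sum.cong refl sum_grid_coordinate) auto
      also have "(\<Sum>b'\<in>G. if b' i = k then 1 else 0) = N / M"
        unfolding N_def G_def using assms(3,4) k by (intro sum_grid_coordinate) auto
      finally show "(\<Sum>b'\<in>G. \<Sum>k'<M. hit b b' k k') = N * (card I + 3)"
        using M2 by (simp add: field_simps)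
    qed
    also have "\<dots> = N\<^sup>2 * M * (card I + 3)" by (simp add: N_def G_def power2_eq_square)
    finally show ?thesis .
  qed
  have "(\<integral>y. (X y)\<^sup>2 \<partial>iid L \<mu>) \<le> (N * M * r)\<^sup>2 + card O' * (e - e\<^sup>2)"
    using moments(3) Te by simp
  also have "card O' * (e - e\<^sup>2) \<le> (N\<^sup>2 * M * (card I + 3)) * (2 * r)"
  proof -
    have "card O' * (e - e\<^sup>2) \<le> card O' * e" by (intro mult_left_mono) auto
    also have "\<dots> \<le> (N\<^sup>2 * M * (card I + 3)) * (2 * r)" using cardO e2r e0 by (intro mult_mono) auto
    finally show ?thesis .
  qed
  finally have "(\<integral>y. (X y)\<^sup>2 \<partial>iid L \<mu>) \<le> (N * M * r)\<^sup>2 + (N\<^sup>2 * M * (card I + 3)) * (2 * r)" by simp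
  then have "(\<integral>y. (X y)\<^sup>2 \<partial>iid L \<mu>) / (N * M)\<^sup>2 \<le> ((N * M * r)\<^sup>2 + (N\<^sup>2 * M * (card I + 3)) * (2 * r)) / (N * M)\<^sup>2"
    by (intro divide_right_mono) auto
  also have "\<dots> = r\<^sup>2 + 2 * (card I + 3) / M * r"
    using N0 M2 by (simp add: field_simps power2_eq_square)
  also have "(\<integral>y. (X y)\<^sup>2 \<partial>iid L \<mu>) / (N * M)\<^sup>2 = (\<integral>y. (R y)\<^sup>2 \<partial>iid L \<mu>)"
    unfolding R_eq power_divide by simp
  finally show "(\<integral>y. (R y)\<^sup>2 \<partial>iid L \<mu>) \<le> (\<integral>y. R y \<partial>iid L \<mu>)\<^sup>2 + 2 * (card I + 3) / M * (\<integral>y. R y \<partial>iid L \<mu>)"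
    by (simp add: r_def)
qed

lemma measurable_section_measure:
  assumes "prob_space \<mu>" "A \<in> sets (iid I \<mu>)" "insert i J = I" "space \<mu> = UNIV"
  shows "(\<lambda>x. measure \<mu> {t. x(i := t) \<in> A}) \<in> borel_measurable (iid J \<mu>)"
    and "x \<in> space (iid J \<mu>) \<Longrightarrow> {t. x(i := t) \<in> A} \<in> sets \<mu>"
proof -
  interpret prob_space \<mu> by fact
  define Q where "Q = (\<lambda>(f, t). f(i := t)) -` A \<inter> space (iid J \<mu> \<Otimes>\<^sub>M \<mu>)"
  have Q: "Q \<in> sets (iid J \<mu> \<Otimes>\<^sub>M \<mu>)"
    unfolding Q_def using measurable_add_dim[of i J "\<lambda>_. \<mu>"] assms(2,3)
    by (auto intro: measurable_sets)
  have slice: "Pair x -` Q = {t. x(i := t) \<in> A}" if "x \<in> space (iid J \<mu>)" for x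
    using that assms(4) by (auto simp: Q_def space_pair_measure)
  show "{t. x(i := t) \<in> A} \<in> sets \<mu>" if "x \<in> space (iid J \<mu>)"
    using sets_Pair1[OF Q, of x] slice[OF that] by simp
  have "(\<lambda>x. measure \<mu> (Pair x -` Q)) \<in> borel_measurable (iid J \<mu>)"
    unfolding measure_def by (intro measurable_compose[OF measurable_emeasure_Pair[OF Q]]) simp
  then show "(\<lambda>x. measure \<mu> {t. x(i := t) \<in> A}) \<in> borel_measurable (iid J \<mu>)"
    by (rule measurable_cong[THEN iffD1, rotated]) (simp add: slice)
qed

lemma capped_supergradient:
  assumes "c \<le> 1/2"
  shows "capped c t \<le> capped c p + (if p \<le> c then 1 else if p \<ge> 1 - c then -1 else 0) * (t - p)"
  using assms by (auto simp: capped_def)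

lemma capped_bounds:
  assumes "0 \<le> c" "0 \<le> t" "t \<le> 1"
  shows "0 \<le> capped c t" "capped c t \<le> 1"
  using assms by (auto simp: capped_def)

text \<open>
  Jensen's inequality for the concave function \<open>capped c\<close>, applied to the empirical measure of a fibre,
  whose mean is the measure of the corresponding section of \<open>A\<close>. It is proved with a supergradient
  at the true section measure: the bound \<open>g\<close> so obtained depends on a single point of the product
  space, and its linear part integrates to zero along direction \<open>i\<close>.
\<close>

lemma sampled_capped:
  fixes I :: "'i set" and \<mu> :: "'a measure"
  assumes "prob_space \<mu>" "space \<mu> = UNIV" "finite I" "i \<in> I" "A \<in> sets (iid I \<mu>)" "M > 0"
    and c: "0 \<le> c" "c \<le> 1/2"
  defines "L \<equiv> I \<times> {..<M}" and "G \<equiv> grid I M"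
    and "W \<equiv> \<lambda>y. (\<Sum>b\<in>grid I M. capped c (fibre_count M (sampled_set I M A y) i b / M))"
  shows "W \<in> borel_measurable (iid L \<mu>)"
    and "(\<integral>y. W y \<partial>iid L \<mu>) \<le> card G * (\<integral>z. capped c (measure \<mu> {t. z(i := t) \<in> A}) \<partial>iid (I - {i}) \<mu>)"
proof -
  interpret P: prob_space "iid L \<mu>" by (intro prob_space_PiM assms)
  interpret PI: prob_space "iid I \<mu>" by (intro prob_space_PiM assms)
  interpret PJ: prob_space "iid (I - {i}) \<mu>" by (intro prob_space_PiM assms)
  interpret mu: prob_space \<mu> by fact
  interpret prod: product_prob_space "\<lambda>_. \<mu>" by (intro product_prob_spaceI assms)
  define x where "x b y = (\<lambda>j\<in>I. y (j, b j))" for b :: "'i \<Rightarrow> nat" and y :: "'i \<times> nat \<Rightarrow> 'a"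
  define p where "p z = measure \<mu> {t. z(i := t) \<in> A}" for z :: "'i \<Rightarrow> 'a"
  define h where "h q = (if q \<le> c then 1 else if q \<ge> 1 - c then -1 else 0 :: real)" for q
  define g where "g z = capped c (p z) + h (p z) * (indicator A z - p z)" for z
  have finG: "finite G" unfolding G_def by (rule finite_grid[OF assms(3)])
  have M0: "real M > 0" using assms(6) by simp
  have ins: "insert i (I - {i}) = I" "insert i I = I" using assms(4) by auto
  have p01: "0 \<le> p z" "p z \<le> 1" for z by (auto simp: p_def)
  have h1: "\<bar>h q\<bar> \<le> 1" for q by (simp add: h_def)
  have cm: "capped c \<in> borel_measurable borel" unfolding capped_def by simp
  have hm: "h \<in> borel_measurable borel" unfolding h_def by simp
  have pI: "p \<in> borel_measurable (iid I \<mu>)" and pJ: "p \<in> borel_measurable (iid (I - {i}) \<mu>)"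
    unfolding p_def using measurable_section_measure(1)[OF assms(1,5) _ assms(2)] ins by auto
  have gm: "g \<in> borel_measurable (iid I \<mu>)"
    unfolding g_def using measurable_compose[OF pI cm] measurable_compose[OF pI hm] pI assms(5)
    by (intro borel_measurable_add borel_measurable_times borel_measurable_diff) auto
  have xm: "x b \<in> measurable (iid L \<mu>) (iid I \<mu>)" if "b \<in> G" for b
    unfolding x_def using that by (intro measurable_reindex) (auto simp: L_def G_def dest: grid_less)
  have xlaw: "(\<integral>y. g (x b y) \<partial>iid L \<mu>) = (\<integral>z. g z \<partial>iid I \<mu>)" if "b \<in> G" for b
    unfolding x_def using that gm
    by (intro integral_reindex assms(1)) (auto simp: inj_on_def L_def G_def dest: grid_less)
  have hd: "\<bar>h (p z) * (indicator A z - p z)\<bar> \<le> 1" for z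
  proof -
    have "\<bar>indicator A z - p z\<bar> \<le> 1" using p01[of z] by (auto simp: indicator_def)
    then show ?thesis unfolding abs_mult using h1[of "p z"] by (intro mult_le_one) auto
  qed
  have gb: "\<bar>g z\<bar> \<le> 2" for z
    using hd[of z] capped_bounds[OF c(1) p01[of z]] unfolding g_def by linarith
  have gI: "integrable (iid I \<mu>) g"
    using gm gb by (intro PI.integrable_const_bound[where B = 2]) auto
  have gL: "integrable (iid L \<mu>) (\<lambda>y. g (x b y))" if "b \<in> G" for b
    using gb measurable_compose[OF xm[OF that] gm] by (intro P.integrable_const_bound[where B = 2]) auto
  have count: "real (fibre_count M (sampled_set I M A y) i b) = (\<Sum>k<M. indicator A (x (b(i := k)) y))"
    if "b \<in> G" for b y
    unfolding fibre_count_sum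
  proof (rule sum.cong[OF refl])
    fix k assume "k \<in> {..<M}"
    then have "b(i := k) \<in> grid I M" using that assms(4) by (simp add: G_def grid_upd)
    then show "(if b(i := k) \<in> sampled_set I M A y then 1 else 0) = (indicator A (x (b(i := k)) y) :: real)"
      by (simp add: sampled_set_iff x_def indicator_def)
  qed
  have upd: "b(i := k) \<in> G" if "b \<in> G" "k < M" for b k
    using that assms(4) by (simp add: G_def grid_upd)
  have cntm: "(\<lambda>y. real (fibre_count M (sampled_set I M A y) i b)) \<in> borel_measurable (iid L \<mu>)" if "b \<in> G" for b
    unfolding count[OF that] using upd[OF that] assms(5)
    by (intro borel_measurable_sum measurable_compose[OF xm]) (simp_all del: fun_upd_apply)
  show Wm: "W \<in> borel_measurable (iid L \<mu>)"
    unfolding W_def using cntm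
    by (intro borel_measurable_sum measurable_compose[OF _ cm] borel_measurable_divide) (auto simp: G_def)
  have Wle: "W y \<le> (\<Sum>b\<in>G. g (x b y))" for y
  proof -
    have "W y \<le> (\<Sum>b\<in>G. (\<Sum>k<M. g (x (b(i := k)) y)) / M)"
      unfolding W_def G_def[symmetric]
    proof (rule sum_mono)
      fix b assume b: "b \<in> G"
      define q where "q = p (x b y)"
      have pk: "p (x (b(i := k)) y) = q" for k
      proof -
        have "(x (b(i := k)) y)(i := t) = (x b y)(i := t)" for t
          by (auto simp: x_def fun_eq_iff)
        then show ?thesis by (simp add: q_def p_def)
      qed
      have "(\<Sum>k<M. g (x (b(i := k)) y)) = (\<Sum>k<M. capped c q + h q * (indicator A (x (b(i := k)) y) - q))"
        by (simp add: g_def pk)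
      also have "\<dots> = M * capped c q + h q * ((\<Sum>k<M. indicator A (x (b(i := k)) y)) - M * q)"
        by (simp add: sum.distrib sum_subtractf flip: sum_distrib_left)
      also have "\<dots> / M = capped c q + h q * (fibre_count M (sampled_set I M A y) i b / M - q)"
        unfolding count[OF b] using M0 by (simp add: field_simps)
      finally show "capped c (fibre_count M (sampled_set I M A y) i b / M) \<le> (\<Sum>k<M. g (x (b(i := k)) y)) / M"
        using capped_supergradient[OF c(2)] by (simp add: h_def)
    qed
    also have "\<dots> = (\<Sum>b\<in>G. g (x b y))"
      unfolding sum_divide_distrib[symmetric] G_def
      using sum_grid_resample[OF assms(3,4), where M = M and G = "\<lambda>b. g (x b y)"] M0 by simp
    finally show ?thesis .
  qed
  have "(\<integral>y. W y \<partial>iid L \<mu>) \<le> (\<integral>y. (\<Sum>b\<in>G. g (x b y)) \<partial>iid L \<mu>)"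
  proof (rule integral_mono)
    have "\<bar>W y\<bar> \<le> card G" for y
    proof -
      have "0 \<le> capped c (fibre_count M (sampled_set I M A y) i b / M)"
        "capped c (fibre_count M (sampled_set I M A y) i b / M) \<le> 1" for b
        using fibre_count_le[of M "sampled_set I M A y" i b] M0 c by (auto intro!: capped_bounds)
      then show ?thesis
        unfolding W_def G_def[symmetric]
        by (intro order_trans[OF sum_abs]) (simp add: sum_bounded_above[where K = 1, simplified])
    qed
    then show "integrable (iid L \<mu>) W"
      using Wm by (intro P.integrable_const_bound[where B = "card G"]) auto
    show "integrable (iid L \<mu>) (\<lambda>y. \<Sum>b\<in>G. g (x b y))" using gL by auto
  qed (rule Wle)
  also have "\<dots> = (\<Sum>b\<in>G. \<integral>y. g (x b y) \<partial>iid L \<mu>)"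
    using gL by (intro Bochner_Integration.integral_sum) auto
  also have "\<dots> = card G * (\<integral>z. g z \<partial>iid I \<mu>)" using xlaw by simp
  also have "(\<integral>z. g z \<partial>iid I \<mu>) = (\<integral>z. \<integral>t. g (z(i := t)) \<partial>\<mu> \<partial>iid (I - {i}) \<mu>)"
    using prod.product_integral_insert[of "I - {i}" i g] gI assms(3) ins by simp
  also have "\<dots> = (\<integral>z. capped c (p z) \<partial>iid (I - {i}) \<mu>)"
  proof (intro Bochner_Integration.integral_cong refl)
    fix z assume "z \<in> space (iid (I - {i}) \<mu>)"
    then have S: "{t. z(i := t) \<in> A} \<in> sets \<mu>"
      using measurable_section_measure(2)[OF assms(1,5) ins(1) assms(2)] by blast
    have "(\<integral>t. g (z(i := t)) \<partial>\<mu>) = (\<integral>t. capped c (p z) + h (p z) * (indicator {t. z(i := t) \<in> A} t - p z) \<partial>\<mu>)"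
      by (intro Bochner_Integration.integral_cong refl) (simp add: g_def p_def indicator_def)
    also have "\<dots> = capped c (p z) + h (p z) * (measure \<mu> {t. z(i := t) \<in> A} - p z)"
    proof -
      have "integrable \<mu> (indicator {t. z(i := t) \<in> A} :: 'a \<Rightarrow> real)"
        using S by (intro mu.integrable_const_bound[where B = 1]) auto
      then show ?thesis using S assms(2) mu.prob_space[unfolded assms(2)] by simp
    qed
    finally show "(\<integral>t. g (z(i := t)) \<partial>\<mu>) = capped c (p z)" by (simp add: p_def)
  qed
  finally show "(\<integral>y. W y \<partial>iid L \<mu>) \<le> card G * (\<integral>z. capped c (measure \<mu> {t. z(i := t) \<in> A}) \<partial>iid (I - {i}) \<mu>)"
    by (simp add: p_def)
qed

section \<open>Entropy influences in product spaces\<close>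

text \<open>
  A concave form of the binary entropy with the logarithm truncated at \<open>K\<close>: about \<open>log 2 (1 / t)\<close> of the
  terms equal \<open>t\<close> when \<open>2 powr - K \<le> t \<le> 1/2\<close>, the others form a geometric series, and below
  \<open>2 powr - K\<close> all \<open>K\<close> terms equal \<open>t\<close>.
\<close>

definition dyadic_entropy :: "nat \<Rightarrow> real \<Rightarrow> real" where
  "dyadic_entropy K t = (\<Sum>k=1..K. capped ((1/2) ^ k) t)"

lemma dyadic_entropy_nonneg: "0 \<le> t \<Longrightarrow> t \<le> 1 \<Longrightarrow> 0 \<le> dyadic_entropy K t"
  unfolding dyadic_entropy_def by (intro sum_nonneg capped_bounds) auto

text \<open>
  The choice of parameters. If \<open>n * \<eta>\<close> were smaller than a small multiple of \<open>v * l\<close>, each summand on the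
  right of the assumed inequality would be a small multiple of \<open>v\<close>. In the last one \<open>d + 1\<close> is at
  least \<open>l / 8\<close>, which absorbs the factor \<open>l\<close>. In the others \<open>(1/2)^l\<close>, which is of order
  \<open>n powr (-1/2)\<close>, is left over, and it beats \<open>3^d\<close> and the powers of \<open>l\<close> because \<open>3^d * l^3\<close>
  is at most \<open>512 * 2^l\<close>.
\<close>

lemma kkl_parameter_estimate:
  fixes n l :: nat and v \<eta> :: real
  assumes l: "l \<ge> 1" "4 ^ (l - 1) < n" "n \<le> 4 ^ l" and v: "0 \<le> v" "v \<le> 1" and \<eta>: "0 \<le> \<eta>"
    and d: "d = l div 8" and M: "M = 256 ^ l"
    and ineq: "4 * ((1 - n / M) * v)
      \<le> 3 ^ d * (n * ((1/2) ^ l * (2 * \<eta>) + 8 * l * (4 * (4 * \<eta>\<^sup>2 + 4 * (n + 3) / M * \<eta>)) / (1/2) ^ l) / 2)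
         + n * (2 * \<eta>) / (real d + 1)"
  shows "v * l / 10 ^ 6 \<le> n * \<eta>"
proof (rule ccontr)
  assume "\<not> ?thesis"
  then have small: "n * \<eta> < v * l / 10 ^ 6" by simp
  define x where "x = n * \<eta>"
  define c :: real where "c = 1 / 10 ^ 6"
  define u where "u = c * v"
  have x0: "0 \<le> x" using \<eta> by (simp add: x_def)
  have xu: "x \<le> u * l" using small by (simp add: x_def c_def u_def)
  have u0: "0 \<le> u" "u \<le> 1" using v by (auto simp: u_def c_def)
  have n1: "n \<ge> 1" using l by auto
  have l0: "real l \<ge> 1" using l by simp
  have growth: "3 ^ d * real l ^ 3 \<le> 512 * 2 ^ l"
  proof -
    have "l \<le> 8 * (d + 1)" unfolding d by simp
    also have "d + 1 \<le> 2 ^ d" by (induction d) auto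
    finally have "l ^ 3 \<le> (8 * 2 ^ d) ^ 3" by (intro power_mono) auto
    then have "3 ^ d * l ^ 3 \<le> 3 ^ d * (8 * 2 ^ d) ^ 3" by simp
    also have "\<dots> = 512 * (3 ^ d * (2 ^ 3) ^ d)" by (simp only: power_mult_distrib power_commutes power_mult[symmetric] mult.commute[of d 3]) simp
    also have "\<dots> = 512 * (3 * 8) ^ d" by (simp flip: power_mult_distrib)
    also have "\<dots> \<le> 512 * (2 ^ 8) ^ d" by (intro mult_left_mono power_mono) auto
    also have "\<dots> = 512 * 2 ^ (8 * d)" by (simp add: power_mult)
    also have "\<dots> \<le> 512 * 2 ^ l" unfolding d by (intro mult_left_mono power_increasing) auto
    finally have "3 ^ d * l ^ 3 \<le> 512 * 2 ^ l" by simp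
    then have "real (3 ^ d * l ^ 3) \<le> real (512 * 2 ^ l)" by (simp only: of_nat_le_iff)
    then show ?thesis by simp
  qed
  define g where "g = 3 ^ d * real l ^ 3 / 2 ^ l"
  have g: "g \<le> 512" "0 \<le> g" using growth by (auto simp: g_def field_simps)
  have pw: "real l \<le> real l ^ 3" "real l ^ 2 \<le> real l ^ 3"
    using power_increasing[of 1 3 "real l"] power_increasing[of 2 3 "real l"] l0 by auto
  have n_le: "real n \<le> 4 ^ l" using of_nat_mono[OF l(3), where 'a = real] by simp
  have n_ge: "4 ^ l \<le> 4 * real n"
  proof -
    have "4 ^ l = 4 * 4 ^ (l - 1)" using l(1) by (cases l) auto
    also have "\<dots> \<le> 4 * n" using l(2) by simp
    finally have "real (4 ^ l) \<le> real (4 * n)" by (simp only: of_nat_le_iff)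
    then show ?thesis by simp
  qed
  have split4: "(4::real) ^ l = 2 ^ l * 2 ^ l" by (simp flip: power_mult_distrib)
  have T1: "3 ^ d * (x / 2 ^ l) \<le> u * g"
  proof -
    have "x \<le> u * real l ^ 3" using xu mult_left_mono[OF pw(1) u0(1)] by linarith
    then have "3 ^ d * (x / 2 ^ l) \<le> 3 ^ d * ((u * real l ^ 3) / 2 ^ l)"
      by (intro mult_left_mono divide_right_mono) auto
    then show ?thesis by (simp add: g_def mult_ac)
  qed
  have T2: "3 ^ d * (64 * l * x\<^sup>2 * 2 ^ l / n) \<le> 256 * u * g"
  proof -
    have "2 ^ l / n \<le> 4 / 2 ^ l" using n_ge n1 by (simp add: split4 field_simps)
    moreover have "x\<^sup>2 \<le> (u * l)\<^sup>2" using xu x0 by (intro power_mono)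
    moreover have "(u * l)\<^sup>2 \<le> u * (real l)\<^sup>2"
      using u0 by (simp add: power_mult_distrib power2_eq_square[of u] mult_left_le mult_right_mono)
    ultimately have "(l * x\<^sup>2) * (2 ^ l / n) \<le> (l * (u * (real l)\<^sup>2)) * (4 / 2 ^ l)"
      using u0 by (intro mult_mono) auto
    then have "3 ^ d * (64 * ((l * x\<^sup>2) * (2 ^ l / n))) \<le> 3 ^ d * (64 * ((l * (u * (real l)\<^sup>2)) * (4 / 2 ^ l)))"
      by (intro mult_left_mono) auto
    then show ?thesis by (simp add: g_def power2_eq_square power3_eq_cube mult_ac)
  qed
  have T3: "3 ^ d * (64 * l * x * (n + 3) / M * 2 ^ l) \<le> 256 * u * g"
  proof -
    have ratio: "real (n + 3) / M * 2 ^ l \<le> 4 / 2 ^ l"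
    proof -
      have "(4 :: real) \<le> 4 ^ l" using l(1) power_increasing[of 1 l "4 :: real"] by simp
      then have "real (n + 3) \<le> 4 * 4 ^ l" unfolding of_nat_add using n_le by linarith
      then have "real (n + 3) * 2 ^ l * 2 ^ l \<le> (4 * 4 ^ l) * 2 ^ l * 2 ^ l" by (intro mult_right_mono) auto
      also have "\<dots> = 4 * 16 ^ l" by (simp add: split4[symmetric] mult.assoc flip: power_mult_distrib)
      also have "\<dots> \<le> 4 * M" unfolding M by (intro mult_left_mono) (auto intro: power_mono)
      finally show ?thesis unfolding M by (simp add: field_simps)
    qed
    have "real l * x \<le> u * (real l)\<^sup>2"
      using mult_left_mono[OF xu, of "real l"] by (simp add: power2_eq_square mult_ac)
    moreover have "u * (real l)\<^sup>2 \<le> u * real l ^ 3" using u0 pw by (intro mult_left_mono) auto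
    ultimately have "real l * x \<le> u * real l ^ 3" by linarith
    then have "(real l * x) * (real (n + 3) / M * 2 ^ l) \<le> (u * real l ^ 3) * (4 / 2 ^ l)"
      using ratio by (rule mult_mono) (use u0 in \<open>auto simp: M\<close>)
    then have "3 ^ d * (64 * ((real l * x) * (real (n + 3) / M * 2 ^ l))) \<le> 3 ^ d * (64 * ((u * real l ^ 3) * (4 / 2 ^ l)))"
      by (intro mult_left_mono) auto
    then show ?thesis by (simp add: g_def mult_ac)
  qed
  have T4: "2 * x / (real d + 1) \<le> 16 * u"
  proof -
    have "real l \<le> 8 * (real d + 1)"
      using of_nat_mono[of l "8 * (d + 1)", where 'a = real] d by simp
    then have "u * l \<le> u * (8 * (real d + 1))" using u0 by (intro mult_left_mono) auto
    then have "2 * x \<le> 16 * u * (real d + 1)" using xu by (simp add: algebra_simps)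
    then show ?thesis by (simp add: pos_divide_le_eq add.commute)
  qed
  have nM: "n / M \<le> 1/2"
  proof -
    have "(4::real) ^ l * 2 \<le> 4 ^ l * 64 ^ l"
      using power_increasing[of 1 l "64::real"] l(1) by (intro mult_left_mono) auto
    also have "\<dots> = M" by (simp add: M flip: power_mult_distrib)
    finally have "n * 2 \<le> M" using n_le by linarith
    then show ?thesis by (simp add: M field_simps)
  qed
  have "3 ^ d * (n * ((1/2) ^ l * (2 * \<eta>) + 8 * l * (4 * (4 * \<eta>\<^sup>2 + 4 * (n + 3) / M * \<eta>)) / (1/2) ^ l) / 2)
         + n * (2 * \<eta>) / (real d + 1)
      = 3 ^ d * (x / 2 ^ l) + 3 ^ d * (64 * l * x\<^sup>2 * 2 ^ l / n) + 3 ^ d * (64 * l * x * (n + 3) / M * 2 ^ l) + 2 * x / (real d + 1)"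
  proof -
    have core: "n * ((1/2) ^ l * (2 * \<eta>) + 8 * l * (4 * (4 * \<eta>\<^sup>2 + 4 * (n + 3) / M * \<eta>)) / (1/2) ^ l) / 2
      = x / 2 ^ l + 64 * l * x\<^sup>2 * 2 ^ l / n + 64 * l * x * (n + 3) / M * 2 ^ l"
      using n1 by (simp add: x_def power_divide field_simps power2_eq_square)
    have linear: "n * (2 * \<eta>) / (real d + 1) = 2 * x / (real d + 1)" by (simp add: x_def)
    show ?thesis unfolding core linear by (simp only: distrib_left)
  qed
  then have "4 * ((1 - n / M) * v) \<le> u * g + 256 * u * g + 256 * u * g + 16 * u"
    using ineq T1 T2 T3 T4 by linarith
  also have "\<dots> \<le> 513 * (u * 512) + 16 * u" using mult_left_mono[OF g(1) u0(1)] by linarith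
  finally have "4 * ((1 - n / M) * v) \<le> 262672 * u" by simp
  moreover have "(1/2) * v \<le> (1 - n / M) * v" using nM v by (intro mult_right_mono) auto
  ultimately have "v \<le> 0" unfolding u_def c_def by simp
  then have "v = 0" using v by simp
  then show False using small x0 by (simp add: x_def)
qed

text \<open>
  The inequality for the grid is applied to the random subset given by a sample of \<open>M = 256^l \<ge> n^4\<close>
  points per coordinate, and integrated. The weight \<open>s = (1/2)^l\<close> balances the first moments, which
  are of order \<open>l / n\<close>, against the second moments, which are of the order of their squares.
\<close>

theorem dyadic_entropy_influence:
  fixes I :: "'i set" and \<mu> :: "'a measure" and \<eta> :: real
  assumes prob: "prob_space \<mu>" "space \<mu> = UNIV" and I: "finite I" "I \<noteq> {}"
    and A: "A \<in> sets (iid I \<mu>)" and l: "l \<ge> 1" "4 ^ (l - 1) < card I" "card I \<le> 4 ^ l"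
    and \<eta>: "\<And>i. i \<in> I \<Longrightarrow> (\<integral>z. dyadic_entropy (8 * l) (measure \<mu> {t. z(i := t) \<in> A}) \<partial>iid (I - {i}) \<mu>) \<le> \<eta>"
  defines "a \<equiv> measure (iid I \<mu>) A"
  shows "a * (1 - a) * l / 10 ^ 6 \<le> card I * \<eta>"
proof -
  define K where "K = 8 * l"
  define M :: nat where "M = 2 ^ K"
  define d where "d = l div 8"
  define s :: real where "s = (1/2) ^ l"
  define n where "n = card I"
  define L where "L = I \<times> {..<M}"
  define G where "G = grid I M"
  define N where "N = real (card G)"
  define C where "C = (\<lambda>y. sampled_set I M A y)"
  define p where "p y i b = real (fibre_count M (C y) i b) / M" for y i b
  define W where "W c i y = (\<Sum>b\<in>G. capped c (p y i b))" for c i y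
  define m where "m y = real (card (C y)) / N" for y
  define R where "R i y = (\<Sum>b\<in>G. \<Sum>k<M. if (b \<in> C y) \<noteq> (b(i := k) \<in> C y) then 1 else 0) / (N * real M)" for i y
  define S where "S i y = (\<Sum>k=1..K. 2 / N * W ((1/2) ^ k) i y)" for i y
  interpret P: prob_space "iid L \<mu>" by (intro prob_space_PiM prob)
  interpret QI: prob_space "iid I \<mu>" by (intro prob_space_PiM prob)
  have K1: "K \<ge> 1" using l(1) by (simp add: K_def)
  have M0: "M > 0" by (simp add: M_def)
  have M2: "M \<ge> 2" using power_increasing[OF K1, of "2::nat"] by (simp add: M_def)
  have s0: "s > 0" by (simp add: s_def)
  have N0: "N > 0" using I M0 by (simp add: N_def G_def card_grid)
  have p01: "0 \<le> p y i b" "p y i b \<le> 1" for y i b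
    using fibre_count_le[of M "C y" i b] M0 by (auto simp: p_def)
  have half: "0 \<le> (1/2 :: real) ^ k" "k \<ge> 1 \<Longrightarrow> (1/2 :: real) ^ k \<le> 1/2" for k
    using power_decreasing[of 1 k "1/2 :: real"] by auto
  define \<theta> where "\<theta> = real (n + 3) / M"
  have W: "W c i \<in> borel_measurable (iid L \<mu>)" "integrable (iid L \<mu>) (W c i)"
    "2 / N * (\<integral>y. W c i y \<partial>iid L \<mu>) \<le> 2 * (\<integral>z. capped c (measure \<mu> {t. z(i := t) \<in> A}) \<partial>iid (I - {i}) \<mu>)"
    if "i \<in> I" "0 \<le> c" "c \<le> 1/2" for c i
  proof -
    show meas: "W c i \<in> borel_measurable (iid L \<mu>)"
      unfolding W_def p_def C_def G_def L_def
      using sampled_capped(1)[OF prob I(1) that(1) A M0 that(2,3)] .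
    have "\<bar>W c i y\<bar> \<le> N" for y
      unfolding W_def N_def
      using capped_bounds[OF that(2) p01]
      by (intro order_trans[OF sum_abs]) (simp add: sum_bounded_above[where K = 1, simplified])
    then show "integrable (iid L \<mu>) (W c i)"
      using meas by (intro P.integrable_const_bound[where B = N]) auto
    have "(\<integral>y. W c i y \<partial>iid L \<mu>) \<le> N * (\<integral>z. capped c (measure \<mu> {t. z(i := t) \<in> A}) \<partial>iid (I - {i}) \<mu>)"
      unfolding W_def p_def C_def G_def L_def N_def
      using sampled_capped(2)[OF prob I(1) that(1) A M0 that(2,3)] .
    then show "2 / N * (\<integral>y. W c i y \<partial>iid L \<mu>) \<le> 2 * (\<integral>z. capped c (measure \<mu> {t. z(i := t) \<in> A}) \<partial>iid (I - {i}) \<mu>)"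
      using N0 by (simp add: field_simps)
  qed
  have sec: "(\<lambda>z. measure \<mu> {t. z(i := t) \<in> A}) \<in> borel_measurable (iid (I - {i}) \<mu>)" if "i \<in> I" for i
    by (rule measurable_section_measure(1)[OF prob(1) A insert_Diff[OF that] prob(2)])
  have sec01: "0 \<le> measure \<mu> B" "measure \<mu> B \<le> 1" for B
    using prob_space.prob_le_1[OF prob(1)] by auto
  have cint: "integrable (iid (I - {i}) \<mu>) (\<lambda>z. capped c (measure \<mu> {t. z(i := t) \<in> A}))"
    if "i \<in> I" "0 \<le> c" for i c
  proof -
    interpret PJ: prob_space "iid (I - {i}) \<mu>" by (intro prob_space_PiM prob)
    have "capped c \<in> borel_measurable borel" unfolding capped_def by simp
    then show ?thesis
      using capped_bounds[OF that(2) sec01] measurable_compose[OF sec[OF that(1)]]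
      by (intro PJ.integrable_const_bound[where B = 1]) auto
  qed
  have ES: "integrable (iid L \<mu>) (S i)" "(\<integral>y. S i y \<partial>iid L \<mu>) \<le> 2 * \<eta>" if "i \<in> I" for i
  proof -
    show "integrable (iid L \<mu>) (S i)" unfolding S_def using W(2)[OF that half] by auto
    have "(\<integral>y. S i y \<partial>iid L \<mu>) = (\<Sum>k=1..K. 2 / N * (\<integral>y. W ((1/2) ^ k) i y \<partial>iid L \<mu>))"
      unfolding S_def using W(2)[OF that half] by (subst Bochner_Integration.integral_sum) auto
    also have "\<dots> \<le> (\<Sum>k=1..K. 2 * (\<integral>z. capped ((1/2) ^ k) (measure \<mu> {t. z(i := t) \<in> A}) \<partial>iid (I - {i}) \<mu>))"
      using that half by (intro sum_mono W(3)) auto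
    also have "\<dots> = 2 * (\<integral>z. dyadic_entropy K (measure \<mu> {t. z(i := t) \<in> A}) \<partial>iid (I - {i}) \<mu>)"
      unfolding dyadic_entropy_def sum_distrib_left[symmetric]
      using cint[OF that half(1)] by (subst Bochner_Integration.integral_sum) auto
    also have "\<dots> \<le> 2 * \<eta>" using \<eta>[OF that] by (simp add: K_def)
    finally show "(\<integral>y. S i y \<partial>iid L \<mu>) \<le> 2 * \<eta>" .
  qed
  have R_eq: "R i y = (\<Sum>b\<in>G. 2 * (p y i b * (1 - p y i b))) / N" if "i \<in> I" for i y
    unfolding R_def G_def p_def using sum_resample_disagreement[OF I(1) that M0] M0 N0 by simp
  have QR: "2 / N * W (1/2) i y \<le> 2 * R i y" "R i y \<le> 2 / N * W (1/2) i y" if "i \<in> I" for i y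
  proof -
    have "W (1/2) i y \<le> (\<Sum>b\<in>G. 2 * (p y i b * (1 - p y i b)))"
      unfolding W_def by (intro sum_mono capped_le_pair_disagreement(1) p01)
    then show "2 / N * W (1/2) i y \<le> 2 * R i y"
      unfolding R_eq[OF that] using N0 by (simp add: field_simps)
    have "(\<Sum>b\<in>G. 2 * (p y i b * (1 - p y i b))) \<le> 2 * W (1/2) i y"
      unfolding W_def sum_distrib_left[symmetric]
      by (intro mult_left_mono sum_mono capped_le_pair_disagreement(2) p01) auto
    then show "R i y \<le> 2 / N * W (1/2) i y"
      unfolding R_eq[OF that] using N0 by (simp add: field_simps)
  qed
  have W0: "W (1/2) i y \<ge> 0" for i y
    unfolding W_def by (intro sum_nonneg capped_bounds p01) simp
  have R0: "R i y \<ge> 0" if "i \<in> I" for i y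
    unfolding R_eq[OF that] using p01 N0 by (intro divide_nonneg_pos sum_nonneg mult_nonneg_nonneg) auto
  have S_half: "2 / N * W (1/2) i y \<le> S i y" for i y
  proof -
    have "0 \<le> 2 / N * W ((1/2) ^ k) i y" for k
      unfolding W_def using N0 by (intro mult_nonneg_nonneg sum_nonneg capped_bounds p01) auto
    then show ?thesis
      using member_le_sum[of 1 "{1..K}" "\<lambda>k. 2 / N * W ((1/2) ^ k) i y"] K1 by (simp add: S_def)
  qed
  have ER: "R i \<in> borel_measurable (iid L \<mu>)" "integrable (iid L \<mu>) (\<lambda>y. (R i y)\<^sup>2)"
     "(\<integral>y. (R i y)\<^sup>2 \<partial>iid L \<mu>) \<le> 4 * \<eta>\<^sup>2 + 4 * \<theta> * \<eta>" if "i \<in> I" for i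
  proof -
    note dis = sampled_disagreement[OF prob I(1) that A M2, folded C_def, folded L_def G_def, folded N_def, folded R_def]
    show meas: "R i \<in> borel_measurable (iid L \<mu>)"
      using dis(1) unfolding R_def by simp
    have Rb: "\<bar>R i y\<bar> \<le> 2" for y
    proof -
      have "W (1/2) i y \<le> N"
        unfolding W_def N_def using capped_bounds(2)[OF _ p01, of "1/2"]
        by (simp add: sum_bounded_above[where K = 1, simplified])
      then have "2 / N * W (1/2) i y \<le> 2" using N0 by (simp add: field_simps)
      then show ?thesis using QR(2)[OF that, of y] R0[OF that, of y] by simp
    qed
    have Ri: "integrable (iid L \<mu>) (R i)"
      using meas Rb by (intro P.integrable_const_bound[where B = 2]) auto
    have "(R i y)\<^sup>2 \<le> 4" for y
      using power_mono[OF Rb[of y], of 2] by simp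
    then show "integrable (iid L \<mu>) (\<lambda>y. (R i y)\<^sup>2)"
      using meas by (intro P.integrable_const_bound[where B = 4]) auto
    define r where "r = (\<integral>y. R i y \<partial>iid L \<mu>)"
    have r0: "0 \<le> r" unfolding r_def by (intro integral_nonneg_AE) (simp add: R0[OF that])
    have "r \<le> (\<integral>y. S i y \<partial>iid L \<mu>)"
      unfolding r_def using QR(2)[OF that] S_half
      by (intro integral_mono Ri ES(1) that) (meson order_trans)
    then have r2: "r \<le> 2 * \<eta>" using ES(2)[OF that] by simp
    have "(\<integral>y. (R i y)\<^sup>2 \<partial>iid L \<mu>) \<le> r\<^sup>2 + 2 * \<theta> * r"
      using dis(2) by (simp add: r_def \<theta>_def n_def R_def)
    also have "\<dots> \<le> (2 * \<eta>)\<^sup>2 + 2 * \<theta> * (2 * \<eta>)"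
      using r0 r2 by (intro add_mono power_mono mult_left_mono) (auto simp: \<theta>_def)
    finally show "(\<integral>y. (R i y)\<^sup>2 \<partial>iid L \<mu>) \<le> 4 * \<eta>\<^sup>2 + 4 * \<theta> * \<eta>"
      by (simp add: power_mult_distrib)
  qed
  have pointwise: "4 * (m y * (1 - m y))
      \<le> 3 ^ d * (\<Sum>i\<in>I. (s * S i y + K * (4 * (R i y)\<^sup>2) / s) / 2) + (\<Sum>i\<in>I. S i y) / (real d + 1)" for y
  proof -
    have "C y \<subseteq> G" by (auto simp: C_def G_def sampled_set_def)
    have S_eq: "S i y = 2 / N * (\<Sum>b\<in>G. \<Sum>k=1..K. capped ((1/2) ^ k) (p y i b))" for i
      unfolding S_def W_def sum_distrib_left[symmetric] by (subst sum.swap) simp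
    have "4 * (m y * (1 - m y))
      \<le> 3 ^ d * (\<Sum>i\<in>I. (s * S i y + K * (2 / N * W (1/2) i y)\<^sup>2 / s) / 2) + (\<Sum>i\<in>I. S i y) / (real d + 1)"
      using grid_kkl[OF I(1) \<open>C y \<subseteq> G\<close>[unfolded G_def M_def] s0, of d]
      unfolding S_eq by (simp add: m_def N_def G_def M_def p_def W_def)
    also have "\<dots> \<le> 3 ^ d * (\<Sum>i\<in>I. (s * S i y + K * (4 * (R i y)\<^sup>2) / s) / 2) + (\<Sum>i\<in>I. S i y) / (real d + 1)"
    proof -
      have "(2 / N * W (1/2) i y)\<^sup>2 \<le> 4 * (R i y)\<^sup>2" if "i \<in> I" for i
        using power_mono[OF QR(1)[OF that, of y], of 2] W0[of i y] N0 by (simp add: power_mult_distrib)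
      then show ?thesis using s0
        by (intro add_right_mono mult_left_mono sum_mono divide_right_mono add_left_mono) auto
    qed
    finally show ?thesis .
  qed
  have var: "(1 - n / M) * (a * (1 - a)) \<le> (\<integral>y. m y * (1 - m y) \<partial>iid L \<mu>)"
    using sampled_variance(2)[OF prob(1) I A M0]
    by (simp add: a_def n_def L_def m_def C_def N_def G_def)
  have m_int: "integrable (iid L \<mu>) (\<lambda>y. m y * (1 - m y))"
  proof -
    have "m \<in> borel_measurable (iid L \<mu>)"
      using sampled_variance(1)[OF prob(1) I A M0] by (simp add: L_def m_def[abs_def] C_def N_def G_def)
    moreover have "0 \<le> m y" "m y \<le> 1" for y
      using N0 card_mono[OF finite_grid[OF I(1)], of "C y" M] by (auto simp: m_def N_def G_def C_def sampled_set_def)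
    ultimately show ?thesis
      by (intro P.integrable_const_bound[where B = 1] borel_measurable_times borel_measurable_diff)
         (auto simp: abs_mult intro!: mult_le_one)
  qed
  have rhs_int: "integrable (iid L \<mu>) (\<lambda>y. (s * S i y + K * (4 * (R i y)\<^sup>2) / s) / 2)" if "i \<in> I" for i
    using ES(1)[OF that] ER(2)[OF that] by auto
  have "4 * ((1 - n / M) * (a * (1 - a))) \<le> (\<integral>y. 4 * (m y * (1 - m y)) \<partial>iid L \<mu>)"
    using var by simp
  also have "\<dots> \<le> (\<integral>y. 3 ^ d * (\<Sum>i\<in>I. (s * S i y + K * (4 * (R i y)\<^sup>2) / s) / 2) + (\<Sum>i\<in>I. S i y) / (real d + 1) \<partial>iid L \<mu>)"
    using pointwise m_int rhs_int ES(1) by (intro integral_mono) auto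
  also have "\<dots> = 3 ^ d * (\<Sum>i\<in>I. (s * (\<integral>y. S i y \<partial>iid L \<mu>) + K * (4 * (\<integral>y. (R i y)\<^sup>2 \<partial>iid L \<mu>)) / s) / 2)
        + (\<Sum>i\<in>I. \<integral>y. S i y \<partial>iid L \<mu>) / (real d + 1)"
    using ES(1) ER(2) by (simp add: Bochner_Integration.integral_sum)
  also have "\<dots> \<le> 3 ^ d * (\<Sum>i\<in>I. (s * (2 * \<eta>) + K * (4 * (4 * \<eta>\<^sup>2 + 4 * \<theta> * \<eta>)) / s) / 2)
        + (\<Sum>i\<in>I. 2 * \<eta>) / (real d + 1)"
    using s0 ES(2) ER(3)
    by (intro add_mono mult_left_mono sum_mono divide_right_mono) auto
  finally have main: "4 * ((1 - n / M) * (a * (1 - a)))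
     \<le> 3 ^ d * (n * (s * (2 * \<eta>) + K * (4 * (4 * \<eta>\<^sup>2 + 4 * \<theta> * \<eta>)) / s) / 2) + n * (2 * \<eta>) / (real d + 1)"
    by (simp add: n_def)
  obtain i where "i \<in> I" using I by blast
  have "0 \<le> (\<integral>z. dyadic_entropy (8 * l) (measure \<mu> {t. z(i := t) \<in> A}) \<partial>iid (I - {i}) \<mu>)"
    by (intro integral_nonneg_AE AE_I2 dyadic_entropy_nonneg sec01)
  then have \<eta>0: "0 \<le> \<eta>" using \<eta>[OF \<open>i \<in> I\<close>] by linarith
  have v: "0 \<le> a * (1 - a)" "a * (1 - a) \<le> 1"
    using QI.prob_le_1[of A] by (auto simp: a_def intro!: mult_le_one)
  have "real M = 256 ^ l" by (simp add: M_def K_def power_mult)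
  then show ?thesis
    using kkl_parameter_estimate[OF l v \<eta>0 d_def, of "real M"] main
    by (simp add: n_def s_def K_def \<theta>_def add.commute)
qed

section \<open>Profiles dominated by the truncated entropy\<close>

lemma capped_symmetric: "capped c (1 - t) = capped c t"
  by (simp add: capped_def min.commute)

lemma dyadic_entropy_symmetric: "dyadic_entropy K (1 - t) = dyadic_entropy K t"
  by (simp add: dyadic_entropy_def capped_symmetric)

lemma dyadic_entropy_le_linear:
  assumes "0 \<le> t" "t \<le> 1"
  shows "dyadic_entropy K t \<le> K * t"
proof -
  have "dyadic_entropy K t \<le> (\<Sum>k=1..K. t)"
    unfolding dyadic_entropy_def by (intro sum_mono) (simp add: capped_def)
  then show ?thesis by simp
qed

text \<open>
  With \<open>r\<close> the integer part of \<open>log 2 (1 / t)\<close>, the first \<open>r\<close> terms are at most \<open>t\<close> and the others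
  sum up to at most \<open>(1/2)^r \<le> 2 * t\<close>; as \<open>r\<close> is at least \<open>1\<close>, the total is at most \<open>3 * r * t\<close>.
\<close>

lemma dyadic_entropy_le_entropy:
  assumes "0 < t" "t \<le> 1/2"
  shows "ln 2 * dyadic_entropy K t \<le> 3 * (t * ln (1 / t))"
proof -
  define r where "r = nat \<lfloor>log 2 (1 / t)\<rfloor>"
  have log1: "1 \<le> log 2 (1 / t)" using assms by (simp add: le_log_iff field_simps)
  then have r: "real r \<le> log 2 (1 / t)" "log 2 (1 / t) < real r + 1" "1 \<le> real r"
    by (auto simp: r_def)
  have "1 / t < 2 ^ (r + 1)"
    using r(2) assms by (simp add: log_less_iff powr_realpow[symmetric] powr_add)
  then have half: "(1/2) ^ r \<le> 2 * t"
    using assms by (simp add: field_simps power_divide)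
  have geom: "(\<Sum>k\<in>{r<..K}. (1/2 :: real) ^ k) \<le> (1/2) ^ r"
  proof -
    have "(\<Sum>k\<in>{r<..r + j}. (1/2 :: real) ^ k) = (1/2) ^ r - (1/2) ^ (r + j)" for j
    proof (induction j)
      case (Suc j)
      have "{r<..r + Suc j} = insert (r + Suc j) {r<..r + j}" by auto
      then show ?case using Suc by simp
    qed simp
    then have "(\<Sum>k\<in>{r<..r + K}. (1/2 :: real) ^ k) \<le> (1/2) ^ r" by simp
    moreover have "(\<Sum>k\<in>{r<..K}. (1/2 :: real) ^ k) \<le> (\<Sum>k\<in>{r<..r + K}. (1/2) ^ k)"
      by (intro sum_mono2) auto
    ultimately show ?thesis by linarith
  qed
  have "dyadic_entropy K t \<le> (\<Sum>k\<in>{1..K}. (if k \<le> r then t else 0) + (if r < k then (1/2) ^ k else 0))"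
    unfolding dyadic_entropy_def by (intro sum_mono) (simp add: capped_def min_le_iff_disj)
  also have "\<dots> = (\<Sum>k\<in>{k\<in>{1..K}. k \<le> r}. t) + (\<Sum>k\<in>{k\<in>{1..K}. r < k}. (1/2) ^ k)"
    unfolding sum.distrib by (simp only: sum.inter_filter finite_atLeastAtMost)
  also have "(\<Sum>k\<in>{k\<in>{1..K}. k \<le> r}. t) \<le> r * t"
  proof -
    have "card {k\<in>{1..K}. k \<le> r} \<le> card {1..r}" by (intro card_mono) auto
    then show ?thesis using assms by (simp add: mult_right_mono)
  qed
  also have "{k\<in>{1..K}. r < k} = {r<..K}" by auto
  also note geom
  also note half
  finally have "dyadic_entropy K t \<le> r * t + 2 * t" by simp
  also have "\<dots> \<le> 3 * (t * r)" using r(3) assms by (simp add: algebra_simps)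
  also have "\<dots> \<le> 3 * (t * log 2 (1 / t))" using r(1) assms by simp
  finally show ?thesis
    using mult_left_mono[of "dyadic_entropy K t" "3 * (t * log 2 (1 / t))" "ln 2"]
    by (simp add: log_def)
qed

lemma essentially_nondecreasingD:
  assumes "essentially_nondecreasing D S f" "D \<ge> 1" "x \<in> S" "y \<in> S" "x \<le> y"
  shows "f x \<le> D * f y"
proof -
  obtain g a where g: "mono_on S g" "a > 0" "\<forall>x\<in>S. a * g x \<le> f x \<and> f x \<le> D * a * g x"
    using assms(1) unfolding essentially_nondecreasing_def approx_const_def by blast
  have "f x \<le> D * (a * g x)" using g(3) assms(3) by (simp add: mult.assoc)
  also have "\<dots> \<le> D * (a * g y)"
    using mono_onD[OF g(1) assms(3-5)] g(2) assms(2) by (intro mult_left_mono) auto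
  also have "\<dots> \<le> D * f y" using g(3) assms(2,4) by (intro mult_left_mono) auto
  finally show ?thesis .
qed

text \<open>
  By symmetry only \<open>t = min p (1 - p)\<close> matters. For \<open>1/n \<le> t\<close> the monotonicity hypothesis compares
  \<open>1/n\<close> with \<open>t\<close>. For \<open>t < 1/n\<close> it compares \<open>1 - 1/n\<close> with \<open>1 - t\<close>, and near \<open>1\<close> the weight
  \<open>x * ln (1 / x)\<close> is of the order of \<open>1 - x\<close>; the resulting linear bound is sufficient since the
  truncated entropy is at most \<open>8 * l * t\<close>.
\<close>

lemma entropy_profile_lower_bound:
  assumes D: "D \<ge> 1" and J0: "J 0 = 0" and sym: "\<forall>t\<in>{0..1}. J t = J (1 - t)"
    and J_nonneg: "\<forall>t\<in>{0..1}. J t \<ge> 0"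
    and ess: "essentially_nondecreasing D {0<..<1} (\<lambda>t. J t / (t * ln (1 / t)))"
    and n: "n \<ge> 2" "n \<le> 4 ^ l" "l \<ge> 1" and p: "0 \<le> p" "p \<le> 1"
  shows "n * J (1 / real n) / (16 * D * l) * dyadic_entropy (8 * l) p \<le> J p"
proof -
  define t where "t = min p (1 - p)"
  define F where "F = (\<lambda>t. J t / (t * ln (1 / t)))"
  define j where "j = J (1 / real n)"
  have t: "0 \<le> t" "t \<le> 1/2" using p by (auto simp: t_def min_def)
  have Jt: "J t = J p" using bspec[OF sym, of p] p by (simp add: t_def min_def)
  have Ht: "dyadic_entropy (8 * l) t = dyadic_entropy (8 * l) p"
    by (auto simp: t_def min_def dyadic_entropy_symmetric)
  have n0: "real n \<ge> 2" using n(1) by simp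
  have j0: "j \<ge> 0" using J_nonneg n0 by (simp add: j_def)
  have F: "F x \<le> D * F y" if "0 < x" "x \<le> y" "y < 1" for x y
    using essentially_nondecreasingD[OF ess D, of x y] that unfolding F_def by simp
  have lnn: "0 < ln (real n)" "ln (real n) \<le> 2 * l * ln 2"
  proof -
    show "0 < ln (real n)" using n0 by simp
    have "real n \<le> 2 ^ (2 * l)"
      using of_nat_mono[OF n(2), where 'a = real] by (simp add: power_mult)
    then have "ln (real n) \<le> ln (2 ^ (2 * l))" using n0 by (subst ln_le_cancel_iff) auto
    then show "ln (real n) \<le> 2 * l * ln 2" by (simp add: ln_realpow)
  qed
  have l0: "real l \<ge> 1" using n(3) by simp
  have "n * j / (16 * D * l) * dyadic_entropy (8 * l) t \<le> J t"
  proof (cases "t = 0")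
    case True
    have "capped ((1/2) ^ k) 0 = 0" for k by (simp add: capped_def)
    then show ?thesis using True J0 by (simp add: dyadic_entropy_def)
  next
    case False
    then have t0: "t > 0" using t by simp
    show ?thesis
    proof (cases "1 / real n \<le> t")
      case True
      have ent: "t * ln (1 / t) > 0" using t0 t by simp
      have "n * j / ln n = F (1 / real n)" using n0 by (simp add: F_def j_def)
      also have "\<dots> \<le> D * (J t / (t * ln (1 / t)))"
        using F[of "1 / real n" t] True n0 t by (simp add: F_def)
      finally have "n * j / ln n * (t * ln (1 / t)) \<le> D * J t"
        using ent by (simp add: field_simps)
      moreover have "n * j / (2 * l * ln 2) * (ln 2 * dyadic_entropy (8 * l) t / 3) \<le> n * j / ln n * (t * ln (1 / t))"
      proof (rule mult_mono)
        show "n * j / (2 * l * ln 2) \<le> n * j / ln n"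
          using lnn n0 j0 l0 by (intro divide_left_mono) auto
        show "ln 2 * dyadic_entropy (8 * l) t / 3 \<le> t * ln (1 / t)"
          using dyadic_entropy_le_entropy[OF t0 t(2), of "8 * l"] by simp
        show "0 \<le> n * j / ln n" using lnn j0 by simp
        show "0 \<le> ln 2 * dyadic_entropy (8 * l) t / 3"
          using dyadic_entropy_nonneg[of t] t by simp
      qed
      ultimately have "n * j / (6 * l) * dyadic_entropy (8 * l) t \<le> D * J t" by simp
      moreover have "n * j / (16 * l) * dyadic_entropy (8 * l) t \<le> n * j / (6 * l) * dyadic_entropy (8 * l) t"
        using j0 l0 dyadic_entropy_nonneg[of t] t
        by (intro mult_right_mono divide_left_mono) auto
      ultimately have "n * j / (16 * l) * dyadic_entropy (8 * l) t \<le> D * J t" by linarith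
      then have "n * j / (16 * l) * dyadic_entropy (8 * l) t / D \<le> J t"
        using D by (subst pos_divide_le_eq) (auto simp: mult.commute)
      then show ?thesis by (simp add: mult_ac)
    next
      case False
      define u where "u = 1 / real n"
      have u: "0 < u" "u \<le> 1/2" "t < u" using False n0 by (auto simp: u_def field_simps)
      have ent_u: "0 < (1 - u) * ln (1 / (1 - u))" "(1 - u) * ln (1 / (1 - u)) \<le> u"
      proof -
        show "0 < (1 - u) * ln (1 / (1 - u))" using u by simp
        have "ln (1 / (1 - u)) \<le> 1 / (1 - u) - 1" using u by (intro ln_le_minus_one) simp
        then have "(1 - u) * ln (1 / (1 - u)) \<le> (1 - u) * (1 / (1 - u) - 1)"
          using u by (intro mult_left_mono) auto
        also have "\<dots> = u" using u by (simp add: right_diff_distrib)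
        finally show "(1 - u) * ln (1 / (1 - u)) \<le> u" .
      qed
      have ent_t: "t / 2 \<le> (1 - t) * ln (1 / (1 - t))"
      proof -
        have "ln (1 - t) \<le> - t" using ln_le_minus_one[of "1 - t"] t by simp
        then have "t \<le> ln (1 / (1 - t))" using t by (simp add: ln_div)
        then have "(1/2) * t \<le> (1 - t) * ln (1 / (1 - t))" using t by (intro mult_mono) auto
        then show ?thesis by simp
      qed
      have "n * j = J (1 - u) / u" using bspec[OF sym, of u] u by (simp add: j_def u_def)
      also have "\<dots> \<le> F (1 - u)"
        unfolding F_def using ent_u J_nonneg u by (intro divide_left_mono) auto
      also have "\<dots> \<le> D * F (1 - t)" using F[of "1 - u" "1 - t"] u t0 by simp
      also have "F (1 - t) \<le> J (1 - t) / (t / 2)"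
        unfolding F_def using ent_t t0 t J_nonneg by (intro divide_left_mono) auto
      also have "J (1 - t) = J t" using bspec[OF sym, of t] t by simp
      finally have "n * j * t \<le> 2 * D * J t" using t0 D by (simp add: field_simps)
      moreover have "n * j / (8 * l) * dyadic_entropy (8 * l) t \<le> n * j / (8 * l) * (8 * l * t)"
        using dyadic_entropy_le_linear[of t "8 * l"] t j0 by (intro mult_left_mono) auto
      ultimately have "n * j / (8 * l) * dyadic_entropy (8 * l) t \<le> 2 * D * J t" using l0 by simp
      then show ?thesis using D l0 by (simp add: field_simps)
    qed
  qed
  then show ?thesis by (simp add: Jt Ht j_def)
qed

lemma exists_power_four_bracket:
  assumes "n \<ge> 2"
  shows "\<exists>l\<ge>1. 4 ^ (l - 1) < n \<and> n \<le> (4::nat) ^ l"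
proof -
  define l where "l = (LEAST l. n \<le> 4 ^ l)"
  have "n < 4 ^ n" by (induction n) auto
  then have "n \<le> 4 ^ n" by simp
  then have l: "n \<le> 4 ^ l" unfolding l_def by (rule LeastI)
  have "l \<noteq> 0" using l assms by (cases l) auto
  moreover have "4 ^ (l - 1) < n" 
    using not_less_Least[of "l - 1" "\<lambda>l. n \<le> 4 ^ l"] \<open>l \<noteq> 0\<close> unfolding l_def[symmetric] by simp
  ultimately show ?thesis using l by (intro exI[of _ l]) auto
qed

section \<open>Geometric influences\<close>

text \<open>
  The boundary measure of the sections need not be a measurable function of \<open>z\<close>. Only the lower bound
  by the truncated entropy is integrated, which is a continuous function of the section measure.
\<close>

lemma geometric_influence_lower_bound:
  assumes prob: "prob_space \<mu>" and sets: "sets \<mu> = sets borel"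
    and iso: "\<forall>t\<in>{0..1}. isoperimetric_function \<mu> t \<ge> ennreal (J t)"
    and lower: "\<And>t. 0 \<le> t \<Longrightarrow> t \<le> 1 \<Longrightarrow> q * dyadic_entropy K t \<le> J t" and q: "q \<ge> 0"
    and A: "A \<in> sets (power_measure n \<mu>)" and i: "i \<in> {1..n}"
  shows "geometric_influence n \<mu> i A
     \<ge> ennreal (q * (\<integral>z. dyadic_entropy K (measure \<mu> {t. z(i := t) \<in> A}) \<partial>PiM ({1..n} - {i}) (\<lambda>_. \<mu>)))"
proof -
  interpret mu: prob_space \<mu> by fact
  interpret PJ: prob_space "PiM ({1..n} - {i}) (\<lambda>_. \<mu>)" by (intro prob_space_PiM prob)
  define p where "p z = measure \<mu> {t. z(i := t) \<in> A}" for z :: "nat \<Rightarrow> real"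
  have sp: "space \<mu> = UNIV" using sets_eq_imp_space_eq[OF sets] by simp
  have A': "A \<in> sets (iid {1..n} \<mu>)" using A by (simp add: power_measure_def)
  have p01: "0 \<le> p z" "p z \<le> 1" for z by (auto simp: p_def)
  have pm: "p \<in> borel_measurable (iid ({1..n} - {i}) \<mu>)"
    unfolding p_def by (rule measurable_section_measure(1)[OF prob A' insert_Diff[OF i] sp])
  have "dyadic_entropy K \<in> borel_measurable borel"
    unfolding dyadic_entropy_def capped_def by measurable
  then have meas: "(\<lambda>z. q * dyadic_entropy K (p z)) \<in> borel_measurable (iid ({1..n} - {i}) \<mu>)"
    using measurable_compose[OF pm] by (intro borel_measurable_times) auto
  have nonneg: "0 \<le> q * dyadic_entropy K (p z)" for z
    using q dyadic_entropy_nonneg[OF p01] by simp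
  have "\<bar>q * dyadic_entropy K (p z)\<bar> \<le> q * K" for z
  proof -
    have "dyadic_entropy K (p z) \<le> K * 1"
      using dyadic_entropy_le_linear[OF p01, of K z] mult_left_mono[OF p01(2), of "real K" z] by linarith
    then show ?thesis using nonneg[of z] q by (simp add: mult_left_mono)
  qed
  then have int: "integrable (iid ({1..n} - {i}) \<mu>) (\<lambda>z. q * dyadic_entropy K (p z))"
    using meas by (intro PJ.integrable_const_bound[where B = "q * K"]) auto
  have "ennreal (q * (\<integral>z. dyadic_entropy K (p z) \<partial>iid ({1..n} - {i}) \<mu>))
      = (\<integral>\<^sup>+ z. ennreal (q * dyadic_entropy K (p z)) \<partial>iid ({1..n} - {i}) \<mu>)"
    using nn_integral_eq_integral[OF int] nonneg by simp
  also have "\<dots> \<le> (\<integral>\<^sup>+ z. outer_boundary_measure \<mu> {y. z(i := y) \<in> A} \<partial>iid ({1..n} - {i}) \<mu>)"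
  proof (rule nn_integral_mono)
    fix z assume "z \<in> space (iid ({1..n} - {i}) \<mu>)"
    then have S: "{y. z(i := y) \<in> A} \<in> sets borel"
      using measurable_section_measure(2)[OF prob A' insert_Diff[OF i] sp] sets by simp
    have "ennreal (q * dyadic_entropy K (p z)) \<le> ennreal (J (p z))"
      using lower[OF p01] by (rule ennreal_leI)
    also have "\<dots> \<le> isoperimetric_function \<mu> (p z)" using iso p01 by auto
    also have "\<dots> \<le> min (outer_boundary_measure \<mu> {y. z(i := y) \<in> A}) (inner_boundary_measure \<mu> {y. z(i := y) \<in> A})"
      unfolding isoperimetric_function_def using S by (intro INF_lower) (simp add: p_def)
    also have "\<dots> \<le> outer_boundary_measure \<mu> {y. z(i := y) \<in> A}" by simp
    finally show "ennreal (q * dyadic_entropy K (p z)) \<le> outer_boundary_measure \<mu> {y. z(i := y) \<in> A}" .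
  qed
  finally show ?thesis by (simp add: geometric_influence_def p_def)
qed

text \<open>
  The truncation level \<open>l\<close> cancels: \<open>J\<close> dominates the truncated entropy times \<open>n * J (1 / n) / l\<close> up
  to constants, and in some direction the truncated entropy has mean of order at least \<open>l / n\<close> times
  the variance of the indicator of \<open>A\<close>.
\<close>

lemma max_geometric_influence_lower_bound:
  assumes prob: "prob_space \<mu>" and sets: "sets \<mu> = sets borel" and D: "D \<ge> 1"
    and J: "\<forall>t\<in>{0..1}. J t \<ge> 0" "\<forall>t\<in>{0..1}. isoperimetric_function \<mu> t \<ge> ennreal (J t)"
      "\<forall>t\<in>{0..1}. J t = J (1 - t)" "J 0 = 0"
      "essentially_nondecreasing D {0<..<1} (\<lambda>t. J t / (t * ln (1 / t)))"
    and n: "n \<ge> 1" and A: "A \<in> sets (power_measure n \<mu>)"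
  shows "(MAX i\<in>{1..n}. geometric_influence n \<mu> i A) \<ge>
     ennreal (measure (power_measure n \<mu>) A
        * measure (power_measure n \<mu>) (space (power_measure n \<mu>) - A) * J (1 / real n) / (16 * 10 ^ 6 * D))"
proof (cases "n = 1")
  case True
  have "J 1 = 0" using J(3,4) by (metis atLeastAtMost_iff diff_self diff_zero le_numeral_extra(3) zero_le_one)
  then show ?thesis using True by simp
next
  case False
  then have n2: "n \<ge> 2" using n by simp
  interpret P: prob_space "power_measure n \<mu>"
    unfolding power_measure_def by (intro prob_space_PiM prob)
  have sp: "space \<mu> = UNIV" using sets_eq_imp_space_eq[OF sets] by simp
  obtain l where l: "l \<ge> 1" "4 ^ (l - 1) < n" "n \<le> 4 ^ l"
    using exists_power_four_bracket[OF n2] by blast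
  define a where "a = measure (power_measure n \<mu>) A"
  define q where "q = n * J (1 / real n) / (16 * D * l)"
  define E where "E i = (\<integral>z. dyadic_entropy (8 * l) (measure \<mu> {t. z(i := t) \<in> A}) \<partial>PiM ({1..n} - {i}) (\<lambda>_. \<mu>))" for i
  have q0: "q \<ge> 0" using J(1) n D by (simp add: q_def)
  have "Max (E ` {1..n}) \<in> E ` {1..n}" using n by (intro Max_in) auto
  then obtain i where i: "i \<in> {1..n}" and Ei: "E i = Max (E ` {1..n})" by auto
  have "a * (1 - a) * l / 10 ^ 6 \<le> card {1..n} * E i"
    unfolding a_def power_measure_def
  proof (rule dyadic_entropy_influence[OF prob sp])
    fix k assume k: "k \<in> {1..n}"
    have "E k \<le> E i" unfolding Ei using k by (intro Max_ge) auto
    then show "(\<integral>z. dyadic_entropy (8 * l) (measure \<mu> {t. z(k := t) \<in> A}) \<partial>PiM ({1..n} - {k}) (\<lambda>_. \<mu>)) \<le> E i"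
      by (simp add: E_def)
  qed (use A n l in \<open>auto simp: power_measure_def\<close>)
  then have "q * (a * (1 - a) * l / 10 ^ 6) / n \<le> q * (n * E i) / n"
    using q0 by (intro divide_right_mono mult_left_mono) auto
  also have "q * (a * (1 - a) * l / 10 ^ 6) / n = a * (1 - a) * J (1 / real n) / (16 * 10 ^ 6 * D)"
    using n l D by (simp add: q_def field_simps)
  also have "q * (n * E i) / n = q * E i" using n by simp
  finally have "ennreal (a * (1 - a) * J (1 / real n) / (16 * 10 ^ 6 * D)) \<le> ennreal (q * E i)"
    by (rule ennreal_leI)
  also have "\<dots> \<le> geometric_influence n \<mu> i A"
    unfolding E_def
  proof (rule geometric_influence_lower_bound[OF prob sets J(2) _ q0 A i])
    fix t :: real assume "0 \<le> t" "t \<le> 1"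
    then show "q * dyadic_entropy (8 * l) t \<le> J t"
      unfolding q_def by (intro entropy_profile_lower_bound[OF D J(4,3,1,5) n2 l(3,1)])
  qed
  also have "\<dots> \<le> (MAX i\<in>{1..n}. geometric_influence n \<mu> i A)" using i by (intro Max_ge) auto
  finally show ?thesis using P.prob_compl[OF A] by (simp add: a_def)
qed

theorem theorem7:
  "\<exists>\<kappa>::real. \<kappa> > 0 \<and>
    (\<exists>\<alpha> :: real \<Rightarrow> real. \<forall>D\<ge>1. \<alpha> D \<ge> \<kappa> / D ^ 3 \<and>
      (\<forall>(\<mu> :: real measure) (\<phi> :: real \<Rightarrow> real) (J :: real \<Rightarrow> real).
         log_concave_prob \<mu> \<and> even_measure \<mu> \<and>
         \<mu> = density lborel (\<lambda>x. ennreal (\<phi> x)) \<and> (\<forall>x. \<phi> x > 0) \<and> C1_bounded \<phi> \<and>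
         (\<forall>t\<in>{0..1}. J t \<ge> 0) \<and>
         (\<forall>t\<in>{0..1}. isoperimetric_function \<mu> t \<ge> ennreal (J t)) \<and>
         (\<forall>t\<in>{0..1}. J t = J (1 - t)) \<and> J 0 = 0 \<and>
         essentially_nondecreasing D {0<..<1} (\<lambda>t. J t / (t * ln (1 / t)))
         \<longrightarrow>
         (\<forall>n\<ge>1. \<forall>A \<in> sets (power_measure n \<mu>).
            (MAX i\<in>{1..n}. geometric_influence n \<mu> i A) \<ge>
            ennreal (\<alpha> D * measure (power_measure n \<mu>) A
                       * measure (power_measure n \<mu>) (space (power_measure n \<mu>) - A)
                       * J (1 / real n)))))"
proof -
  define \<kappa> :: real where "\<kappa> = 1 / (16 * 10 ^ 6)"
  \<comment> \<open>The monotonicity hypothesis is used once for each value of the section measure, which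
    costs a single factor \<open>D\<close>.\<close>
  define \<alpha> :: "real \<Rightarrow> real" where "\<alpha> D = \<kappa> / D" for D
  have "\<kappa> / D ^ 3 \<le> \<alpha> D" if "D \<ge> 1" for D
    unfolding \<alpha>_def using that power_increasing[of 1 3 D] by (intro divide_left_mono) (auto simp: \<kappa>_def)
  moreover have "(MAX i\<in>{1..n}. geometric_influence n \<mu> i A) \<ge>
            ennreal (\<alpha> D * measure (power_measure n \<mu>) A
                       * measure (power_measure n \<mu>) (space (power_measure n \<mu>) - A)
                       * J (1 / real n))"
    if "D \<ge> 1" "log_concave_prob \<mu>" "\<mu> = density lborel (\<lambda>x. ennreal (\<phi> x))"
      "\<forall>t\<in>{0..1}. J t \<ge> 0" "\<forall>t\<in>{0..1}. isoperimetric_function \<mu> t \<ge> ennreal (J t)"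
      "\<forall>t\<in>{0..1}. J t = J (1 - t)" "J 0 = 0"
      "essentially_nondecreasing D {0<..<1} (\<lambda>t. J t / (t * ln (1 / t)))"
      "n \<ge> 1" "A \<in> sets (power_measure n \<mu>)" for D \<mu> \<phi> J n A
  proof -
    have "prob_space \<mu>" using that(2) by (simp add: log_concave_prob_def)
    moreover have "sets \<mu> = sets borel" using that(3) by simp
    ultimately show ?thesis
      using max_geometric_influence_lower_bound[OF _ _ that(1,4-10)]
      by (simp add: \<alpha>_def \<kappa>_def mult_ac)
  qed
  moreover have "\<kappa> > 0" by (simp add: \<kappa>_def)
  ultimately show ?thesis by (intro exI[of _ \<kappa>] conjI exI[of _ \<alpha>]) blast+
qed

end
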